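(* Consider a non-autonomous system $\dot{\mathbf{x}}=\mathbf{h}(\mathbf{x},t)$ on $\mathbb{R}^n$ which is semi-contracting in a bounded metric $\mathbf{M}(\mathbf{x})$, i.e. there are constants $\beta_0,\beta_1$ with $$\mathbf{0}\prec\beta_0^2\,\mathbf{I}\preceq\mathbf{M}(\mathbf{x})\preceq\beta_1^2\,\mathbf{I}\qquad\text{for all }\mathbf{x}.$$ Assume that a specific trajectory $\mathbf{x}^\star(t)$ is locally attractive. Then all trajectories tend asymptotically to $\mathbf{x}^\star(t)$. In particular, if contraction holds (possibly in a different bounded metric) along a specific trajectory $\mathbf{x}^\star(t)$ and within a tube of constant size around it, then all trajectories tend asymptotically to $\mathbf{x}^\star(t)$.
   Context: All functions are assumed sufficiently smooth that derivatives of the necessary order exist and are continuous. A metric is a function $\mathbf{M}:\mathbb{R}^n\to\mathbb{R}^{n\times n}$ whose values are symmetric positive definite matrices. For a system $\dot{\mathbf{x}}=\mathbf{h}(\mathbf{x},t)$, a metric $\mathbf{M}$ and $\alpha\ge 0$, consider the contraction condition $$\dot{\mathbf{M}}+\mathbf{A}^\top\mathbf{M}+\mathbf{M}\mathbf{A}\preceq-2\alpha\mathbf{M},\qquad \mathbf{A}(\mathbf{x},t)=\frac{\partial\mathbf{h}}{\partial\mathbf{x}},\quad \dot{\mathbf{M}}=\sum_i\frac{\partial\mathbf{M}}{\partial x_i}h_i(\mathbf{x},t).\qquad( * )$$ The system is semi-contracting in $\mathbf{M}$ if $( * )$ holds with $\alpha=0$ for all $t\in\mathbb{R}$ and $\mathbf{x}\in\mathbb{R}^n$.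 $\mathbf{x}(t;\mathbf{x}_0,t_0)$ denotes the solution with $\mathbf{x}(t_0)=\mathbf{x}_0$. A trajectory $\mathbf{x}^\star(t)$ is locally attractive if there exists $\epsilon>0$ such that for every initial time $t_0$ and every $\mathbf{x}_0$ in the Euclidean ball of radius $\epsilon$ around $\mathbf{x}^\star(t_0)$, $\mathbf{x}(t_0+T;\mathbf{x}_0,t_0)-\mathbf{x}^\star(t_0+T)\to\mathbf{0}$ as $T\to+\infty$. Contraction within a tube of constant size around $\mathbf{x}^\star(t)$ in a bounded metric means: there exist a metric $\mathbf{M}^\star$ with $\mathbf{0}\prec(\beta_0^\star)^2\mathbf{I}\preceq\mathbf{M}^\star(\mathbf{x})\preceq(\beta_1^\star)^2\mathbf{I}$ for some constants $\beta_0^\star,\beta_1^\star$, a rate $\alpha^\star>0$, and $\epsilon>0$ such that $( * )$ holds with $\mathbf{M}=\mathbf{M}^\star$ and $\alpha=\alpha^\star$ for every time $t$ and every $\mathbf{x}$ in the Euclidean ball of radius $\epsilon$ around $\mathbf{x}^\star(t)$. A trajectory $\mathbf{x}(t)$ tends asymptotically to $\mathbf{x}^\star(t)$ if $\|\mathbf{x}(t)-\mathbf{x}^\star(t)\|\to0$ as $t\to+\infty$. *)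

theory Defs
  imports "HOL-Analysis.Analysis"
begin

definition pos_semidef :: "real^'n^'n \<Rightarrow> bool"
  where "pos_semidef A \<longleftrightarrow> transpose A = A \<and> (\<forall>v. 0 \<le> v \<bullet> (A *v v))"

definition pos_def :: "real^'n^'n \<Rightarrow> bool"
  where "pos_def A \<longleftrightarrow> transpose A = A \<and> (\<forall>v. v \<noteq> 0 \<longrightarrow> 0 < v \<bullet> (A *v v))"

definition loewner_le :: "real^'n^'n \<Rightarrow> real^'n^'n \<Rightarrow> bool"  (infix "\<preceq>\<^sub>L" 50)
  where "A \<preceq>\<^sub>L B \<longleftrightarrow> pos_semidef (B - A)"

definition loewner_less :: "real^'n^'n \<Rightarrow> real^'n^'n \<Rightarrow> bool"  (infix "\<prec>\<^sub>L" 50)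
  where "A \<prec>\<^sub>L B \<longleftrightarrow> pos_def (B - A)"

definition partial_deriv :: "'n::finite \<Rightarrow> (real^'n \<Rightarrow> 'b::real_normed_vector) \<Rightarrow> real^'n \<Rightarrow> 'b"
  where "partial_deriv i f x = frechet_derivative f (at x) (axis i 1)"

text \<open>The smoothness required of the vector field: jointly continuous in state and time, with a
  jointly continuous state derivative; no differentiability in time.\<close>

definition smooth_vector_field :: "(real^'n \<Rightarrow> real \<Rightarrow> real^'n) \<Rightarrow> bool"
  where "smooth_vector_field h \<longleftrightarrow>
    continuous_on UNIV (\<lambda>(x, t). h x t) \<and>
    (\<forall>x t. (\<lambda>y. h y t) differentiable (at x)) \<and>
    continuous_on UNIV (\<lambda>(x, t). jacobian (\<lambda>y. h y t) (at x))"

definition is_metric :: "(real^'n \<Rightarrow> real^'n^'n) \<Rightarrow> bool"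
  where "is_metric M \<longleftrightarrow>
    (\<forall>x. pos_def (M x)) \<and>
    (\<forall>x. M differentiable (at x)) \<and>
    (\<forall>i. continuous_on UNIV (partial_deriv i M))"

definition bounded_metric :: "(real^'n \<Rightarrow> real^'n^'n) \<Rightarrow> real \<Rightarrow> real \<Rightarrow> bool"
  where "bounded_metric M \<beta>\<^sub>0 \<beta>\<^sub>1 \<longleftrightarrow> is_metric M \<and>
    0 \<prec>\<^sub>L \<beta>\<^sub>0\<^sup>2 *\<^sub>R (mat 1 :: real^'n^'n) \<and>
    (\<forall>x. \<beta>\<^sub>0\<^sup>2 *\<^sub>R mat 1 \<preceq>\<^sub>L M x \<and> M x \<preceq>\<^sub>L \<beta>\<^sub>1\<^sup>2 *\<^sub>R mat 1)"

definition metric_dot ::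
    "(real^'n \<Rightarrow> real \<Rightarrow> real^'n) \<Rightarrow> (real^'n \<Rightarrow> real^'n^'n) \<Rightarrow> real^'n \<Rightarrow> real \<Rightarrow> real^'n^'n"
  where "metric_dot h M x t = (\<Sum>i\<in>UNIV. (h x t $ i) *\<^sub>R partial_deriv i M x)"

definition contraction_condition ::
    "(real^'n \<Rightarrow> real \<Rightarrow> real^'n) \<Rightarrow> (real^'n \<Rightarrow> real^'n^'n) \<Rightarrow> real \<Rightarrow> real^'n \<Rightarrow> real \<Rightarrow> bool"
  where "contraction_condition h M \<alpha> x t \<longleftrightarrow>
    metric_dot h M x t + transpose (jacobian (\<lambda>y. h y t) (at x)) ** M x +
      M x ** jacobian (\<lambda>y. h y t) (at x)
      \<preceq>\<^sub>L (- 2 * \<alpha>) *\<^sub>R M x"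

definition semi_contracting ::
    "(real^'n \<Rightarrow> real \<Rightarrow> real^'n) \<Rightarrow> (real^'n \<Rightarrow> real^'n^'n) \<Rightarrow> bool"
  where "semi_contracting h M \<longleftrightarrow> (\<forall>t x. contraction_condition h M 0 x t)"

definition complete_trajectory :: "(real^'n \<Rightarrow> real \<Rightarrow> real^'n) \<Rightarrow> (real \<Rightarrow> real^'n) \<Rightarrow> bool"
  where "complete_trajectory h x \<longleftrightarrow> (\<forall>t. (x has_vector_derivative h (x t) t) (at t))"

text \<open>\<open>forward_solution h x0 t0 x\<close>: on \<open>[t0, \<infinity>)\<close> the function \<open>x\<close> is the solution with
  \<open>x t0 = x0\<close>; its values before \<open>t0\<close> are irrelevant. For a smooth vector field, the solution is
  unique on \<open>[t0, \<infinity>)\<close> but need not exist, so existence is stated separately below.\<close>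

definition forward_solution ::
    "(real^'n \<Rightarrow> real \<Rightarrow> real^'n) \<Rightarrow> real^'n \<Rightarrow> real \<Rightarrow> (real \<Rightarrow> real^'n) \<Rightarrow> bool"
  where "forward_solution h x0 t0 x \<longleftrightarrow> x t0 = x0 \<and>
    (\<forall>t\<ge>t0. (x has_vector_derivative h (x t) t) (at t within {t0..}))"

definition tends_asymptotically_to :: "(real \<Rightarrow> real^'n) \<Rightarrow> (real \<Rightarrow> real^'n) \<Rightarrow> bool"
  where "tends_asymptotically_to x xs \<longleftrightarrow> ((\<lambda>t. norm (x t - xs t)) \<longlongrightarrow> 0) at_top"

definition locally_attractive ::
    "(real^'n \<Rightarrow> real \<Rightarrow> real^'n) \<Rightarrow> (real \<Rightarrow> real^'n) \<Rightarrow> bool"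
  where "locally_attractive h xs \<longleftrightarrow> (\<exists>\<epsilon>>0. \<forall>t0. \<forall>x0\<in>ball (xs t0) \<epsilon>.
    (\<exists>x. forward_solution h x0 t0 x) \<and>
    (\<forall>x. forward_solution h x0 t0 x \<longrightarrow> ((\<lambda>T. x (t0 + T) - xs (t0 + T)) \<longlongrightarrow> 0) at_top))"

definition contracting_in_tube ::
    "(real^'n \<Rightarrow> real \<Rightarrow> real^'n) \<Rightarrow> (real \<Rightarrow> real^'n) \<Rightarrow> bool"
  where "contracting_in_tube h xs \<longleftrightarrow> (\<exists>M \<beta>\<^sub>0 \<beta>\<^sub>1 \<alpha> \<epsilon>.
    bounded_metric M \<beta>\<^sub>0 \<beta>\<^sub>1 \<and> \<alpha> > 0 \<and> \<epsilon> > 0 \<and>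
    (\<forall>t. \<forall>x\<in>ball (xs t) \<epsilon>. contraction_condition h M \<alpha> x t))"

definition all_trajectories_tend_to ::
    "(real^'n \<Rightarrow> real \<Rightarrow> real^'n) \<Rightarrow> (real \<Rightarrow> real^'n) \<Rightarrow> bool"
  where "all_trajectories_tend_to h xs \<longleftrightarrow> (\<forall>t0 x0.
    (\<exists>x. forward_solution h x0 t0 x) \<and>
    (\<forall>x. forward_solution h x0 t0 x \<longrightarrow> tends_asymptotically_to x xs))"

end

theory Submission
  imports Defs
begin

text \<open>The energy of a curve joining two solutions does not grow along the flow. Rather than
  differentiating the flow with respect to its initial value, a \<open>C\<^sup>1\<close> curve joining \<open>x t\<close> to \<open>y t\<close>
  is pushed by one Euler step \<open>c \<mapsto> c + \<tau> h(c, t)\<close>, and its end points are corrected affinely to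
  \<open>x (t + \<tau>)\<close> and \<open>y (t + \<tau>)\<close>; on compact sets the energy grows at most by the contraction factor
  and an error \<open>o(\<tau>)\<close>, uniformly. Summing over a fine partition gives
  \<open>\<beta>\<^sub>0\<^sup>2 |x b - y b|\<^sup>2 \<le> exp (- 2 \<alpha> (b - a)) \<beta>\<^sub>1\<^sup>2 |x a - y a|\<^sup>2\<close>, also if the contraction condition is
  only known in a tube which the curves cannot leave.

  With \<open>\<alpha> = 0\<close> solutions depend Lipschitz continuously on the initial value, uniformly in time.
  Hence they cannot blow up, and the attracted initial values contain with each point a ball of
  fixed radius, so every initial value is attracted.\<close>

subsection \<open>Quadratic forms and bounded metrics\<close>

text \<open>\<open>norm\<close> on matrices is the Frobenius norm, the \<open>L2_set\<close> norm of
  the row norms, so Cauchy-Schwarz in each row suffices.\<close>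

lemma norm_matrix_vector_mult_le:
  fixes A :: "real^'n^'m"
  shows "norm (A *v x) \<le> norm A * norm x"
proof -
  have "norm (A *v x) = L2_set (\<lambda>i. \<bar>A $ i \<bullet> x\<bar>) UNIV"
    by (simp add: norm_vec_def matrix_mult_dot)
  also have "\<dots> \<le> L2_set (\<lambda>i. norm (A $ i) * norm x) UNIV"
    by (rule L2_set_mono) (auto simp: Cauchy_Schwarz_ineq2)
  also have "\<dots> = norm A * norm x"
    by (simp add: norm_vec_def[of A] L2_set_left_distrib)
  finally show ?thesis .
qed

lemma bounded_bilinear_matrix_vector_mult:
  "bounded_bilinear ((*v) :: real^'n^'m \<Rightarrow> real^'n \<Rightarrow> real^'m)"
  by (rule bounded_bilinear.intro)
     (auto simp: matrix_vector_mult_add_rdistrib matrix_vector_right_distrib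
       scaleR_matrix_vector_assoc matrix_vector_mult_scaleR
       intro!: exI[of _ 1] norm_matrix_vector_mult_le)

lemmas continuous_on_matrix_vector_mult [continuous_intros] =
  bounded_bilinear.continuous_on[OF bounded_bilinear_matrix_vector_mult]

lemma inner_matrix_vector_le:
  fixes A :: "real^'n^'m"
  shows "\<bar>u \<bullet> (A *v v)\<bar> \<le> norm A * norm u * norm v"
proof -
  have "\<bar>u \<bullet> (A *v v)\<bar> \<le> norm u * norm (A *v v)"
    by (rule Cauchy_Schwarz_ineq2)
  also have "\<dots> \<le> norm u * (norm A * norm v)"
    by (intro mult_left_mono norm_matrix_vector_mult_le) auto
  finally show ?thesis by (simp add: mult_ac)
qed

lemma symmetric_matrix_inner:
  fixes A :: "real^'n^'n"
  assumes "transpose A = A"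
  shows "u \<bullet> (A *v v) = v \<bullet> (A *v u)"
  using assms by (metis dot_lmul_matrix inner_commute transpose_matrix_vector)

lemma symmetric_quadratic_add:
  fixes A :: "real^'n^'n"
  assumes "transpose A = A"
  shows "(v + k) \<bullet> (A *v (v + k)) = v \<bullet> (A *v v) + 2 * (v \<bullet> (A *v k)) + k \<bullet> (A *v k)"
  using symmetric_matrix_inner[OF assms, of k v]
  by (simp add: matrix_vector_right_distrib inner_add_left inner_add_right)

lemma loewner_le_quadratic:
  assumes "A \<preceq>\<^sub>L B"
  shows "v \<bullet> (A *v v) \<le> v \<bullet> (B *v v)"
  using assms unfolding loewner_le_def pos_semidef_def
  by (auto simp: matrix_vector_mult_diff_rdistrib inner_diff_right)

section \<open>Bounds, symmetry and derivative of a bounded metric\<close>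

context
  fixes M :: "real^'n \<Rightarrow> real^'n^'n" and \<beta>\<^sub>0 \<beta>\<^sub>1 :: real
  assumes M: "bounded_metric M \<beta>\<^sub>0 \<beta>\<^sub>1"
begin

lemma bounded_metric_lower_pos: "0 < \<beta>\<^sub>0\<^sup>2"
proof -
  \<comment> \<open>Any nonzero vector would do: positive definiteness of the scaled identity,
    tested on one, excludes the value zero for the scalar.\<close>
  have "0 < axis undefined 1 \<bullet> ((\<beta>\<^sub>0\<^sup>2 *\<^sub>R (mat 1 :: real^'n^'n)) *v axis undefined 1)"
    using M unfolding bounded_metric_def loewner_less_def pos_def_def
    by (metis axis_eq_0_iff diff_zero zero_neq_one)
  then show ?thesis
    by (simp add: scaleR_matrix_vector_assoc[symmetric])
qed

lemma bounded_metric_lower: "\<beta>\<^sub>0\<^sup>2 * (norm v)\<^sup>2 \<le> v \<bullet> (M x *v v)"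
proof -
  have "v \<bullet> ((\<beta>\<^sub>0\<^sup>2 *\<^sub>R (mat 1 :: real^'n^'n)) *v v) \<le> v \<bullet> (M x *v v)"
    using M unfolding bounded_metric_def by (blast intro: loewner_le_quadratic)
  then show ?thesis
    by (simp add: scaleR_matrix_vector_assoc[symmetric] power2_norm_eq_inner)
qed

lemma bounded_metric_upper: "v \<bullet> (M x *v v) \<le> \<beta>\<^sub>1\<^sup>2 * (norm v)\<^sup>2"
proof -
  have "v \<bullet> (M x *v v) \<le> v \<bullet> ((\<beta>\<^sub>1\<^sup>2 *\<^sub>R (mat 1 :: real^'n^'n)) *v v)"
    using M unfolding bounded_metric_def by (blast intro: loewner_le_quadratic)
  then show ?thesis
    by (simp add: scaleR_matrix_vector_assoc[symmetric] power2_norm_eq_inner)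
qed

lemma bounded_metric_symmetric: "transpose (M x) = M x"
  using M unfolding bounded_metric_def is_metric_def pos_def_def by auto

text \<open>Expanding \<open>k\<close> in the standard basis turns the Frechet derivative into a sum
  of partial derivatives. At \<open>k = h x t\<close> this sum is
  \<open>metric_dot h M x t\<close>.\<close>

lemma bounded_metric_has_derivative:
  "(M has_derivative (\<lambda>k. \<Sum>i\<in>UNIV. (k $ i) *\<^sub>R partial_deriv i M x)) (at x)"
proof -
  have d: "(M has_derivative frechet_derivative M (at x)) (at x)"
    using M unfolding bounded_metric_def is_metric_def
    by (metis frechet_derivative_works)
  then interpret D: bounded_linear "frechet_derivative M (at x)"
    by (rule has_derivative_bounded_linear)
  have "frechet_derivative M (at x) k = (\<Sum>i\<in>UNIV. (k $ i) *\<^sub>R partial_deriv i M x)" for k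
  proof -
    have "frechet_derivative M (at x) k
        = frechet_derivative M (at x) (\<Sum>i\<in>UNIV. (k $ i) *\<^sub>R axis i 1)"
      by (simp add: basis_expansion flip: scalar_mult_eq_scaleR)
    then show ?thesis
      by (simp add: D.sum D.scaleR partial_deriv_def)
  qed
  then show ?thesis using d by (metis (no_types, lifting) ext)
qed

lemma bounded_metric_continuous: "continuous_on UNIV M"
  using bounded_metric_has_derivative has_derivative_continuous continuous_at_imp_continuous_on
  by blast

end

text \<open>Since \<open>M x\<close> is symmetric, both Jacobian terms take the same value on
  \<open>v\<close>. The left side is the rate of change of \<open>v \<bullet> (M x *v v)\<close>
  when \<open>x\<close> follows the flow and \<open>v\<close> the linearized flow.\<close>

lemma contraction_condition_quadratic:
  fixes M :: "real^'n \<Rightarrow> real^'n^'n"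
  assumes "transpose (M x) = M x" and "contraction_condition h M \<alpha> x t"
  shows "v \<bullet> (metric_dot h M x t *v v) + 2 * (v \<bullet> (M x *v (jacobian (\<lambda>y. h y t) (at x) *v v)))
    \<le> - 2 * \<alpha> * (v \<bullet> (M x *v v))"
proof -
  let ?A = "jacobian (\<lambda>y. h y t) (at x)"
  have "v \<bullet> (transpose ?A *v (M x *v v)) = (?A *v v) \<bullet> (M x *v v)"
    by (metis dot_lmul_matrix inner_commute transpose_matrix_vector transpose_transpose)
  also have "\<dots> = v \<bullet> (M x *v (?A *v v))"
    using assms(1) by (rule symmetric_matrix_inner)
  finally have transpose_term: "v \<bullet> (transpose ?A *v (M x *v v)) = v \<bullet> (M x *v (?A *v v))" .
  have "((- 2 * \<alpha>) *\<^sub>R M x) *v v = (- 2 * \<alpha>) *\<^sub>R (M x *v v)"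
    by (rule scaleR_matrix_vector_assoc[symmetric])
  then have "v \<bullet> (((- 2 * \<alpha>) *\<^sub>R M x) *v v) = - 2 * \<alpha> * (v \<bullet> (M x *v v))"
    by simp
  moreover have "v \<bullet> ((metric_dot h M x t + transpose ?A ** M x + M x ** ?A) *v v)
    = v \<bullet> (metric_dot h M x t *v v) + 2 * (v \<bullet> (M x *v (?A *v v)))"
    using transpose_term unfolding matrix_vector_mult_add_rdistrib inner_add_right
      matrix_vector_mul_assoc[symmetric] by linarith
  ultimately show ?thesis
    using loewner_le_quadratic[OF assms(2)[unfolded contraction_condition_def], of v] by linarith
qed

lemma uniformly_continuous_modulus:
  fixes f :: "'a::heine_borel \<Rightarrow> 'b::metric_space"
  assumes "continuous_on K f" "compact K" "0 < \<eta>"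
  obtains \<delta> where "0 < \<delta>" "\<And>p q. p \<in> K \<Longrightarrow> q \<in> K \<Longrightarrow> dist p q < \<delta> \<Longrightarrow> dist (f p) (f q) < \<eta>"
  using compact_uniformly_continuous[OF assms(1,2)] assms(3)
  unfolding uniformly_continuous_on_def by metis

lemma norm_sum_scaleR_component_le:
  fixes P :: "'n::finite \<Rightarrow> 'b::real_normed_vector" and k :: "real^'n"
  assumes "\<And>i. norm (P i) \<le> B"
  shows "norm (\<Sum>i\<in>UNIV. (k $ i) *\<^sub>R P i) \<le> real CARD('n) * B * norm k"
proof -
  have "norm (\<Sum>i\<in>UNIV. (k $ i) *\<^sub>R P i) \<le> (\<Sum>i\<in>(UNIV::'n set). norm k * B)"
    by (rule sum_norm_le) (simp add: assms component_le_norm_cart mult_mono)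
  then show ?thesis by (simp add: mult_ac)
qed

subsection \<open>One Euler step\<close>

text \<open>First-order expansion in \<tau>. Here \<open>N\<close> and \<open>N'\<close> stand for
  the metric before and after the step, \<open>D\<close> for its derivative along the field,
  \<open>A\<close> for the Jacobian. The increment of \<open>v\<close> has order \<tau> and \<tau>
  \<le> \<delta>, so second-order terms cost a multiple of \<open>\<tau> * \<delta>\<close>. The
  factor \<open>1 + (norm v)\<^sup>2\<close> is needed because \<open>e\<close> does not scale with
  \<open>v\<close>.\<close>

lemma quadratic_form_perturbation:
  fixes N N' D A :: "real^'n^'n" and v e :: "real^'n"
  assumes sym: "transpose N' = N'"
    and N: "norm N \<le> B" and A: "norm A \<le> B" and D: "norm D \<le> B * B"
    and R: "norm (N' - N - \<tau> *\<^sub>R D) \<le> \<tau> * r"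
    and e: "norm e \<le> \<delta> * \<tau>" and \<tau>: "0 \<le> \<tau>" "\<tau> \<le> \<delta>" and \<delta>: "\<delta> \<le> 1" and r: "r \<le> 1"
  defines "w \<equiv> v + (\<tau> *\<^sub>R (A *v v) + e)"
    and "C \<equiv> 2 * B + 2 * (1 + B * B) * (B + 1) + (1 + B + B * B) * (B + 1)\<^sup>2"
  shows "w \<bullet> (N' *v w) \<le> v \<bullet> (N *v v) + \<tau> * (v \<bullet> (D *v v) + 2 * (v \<bullet> (N *v (A *v v))))
    + \<tau> * (r + C * \<delta>) * (1 + (norm v)\<^sup>2)"
proof -
  define k where "k = \<tau> *\<^sub>R (A *v v) + e"
  define n where "n = 1 + (norm v)\<^sup>2"
  have B0: "0 \<le> B" using N norm_ge_zero order_trans by blast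
  have n1: "1 \<le> n" and vv: "(norm v)\<^sup>2 \<le> n" unfolding n_def by auto
  have v2: "2 * norm v \<le> n"
    using zero_le_power2[of "norm v - 1"] unfolding n_def power2_diff by simp
  have "norm (A *v v) \<le> B * norm v"
    using norm_matrix_vector_mult_le[of A v] mult_right_mono[OF A norm_ge_zero[of v]] by linarith
  then have "norm (\<tau> *\<^sub>R (A *v v)) \<le> \<tau> * (B * norm v)"
    using \<tau>(1) by (simp add: mult_left_mono)
  moreover have "norm e \<le> \<tau>"
    using e mult_right_mono[OF \<delta> \<tau>(1)] by simp
  ultimately have "norm k \<le> \<tau> * (B * norm v) + \<tau>"
    unfolding k_def using norm_triangle_ineq[of "\<tau> *\<^sub>R (A *v v)" e] by linarith
  then have k: "norm k \<le> \<tau> * (B * norm v + 1)"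
    by (simp add: distrib_left)
  have Bv: "0 \<le> B * norm v + 1" using B0 by simp
  have vk: "norm v * (B * norm v + 1) \<le> (B + 1) * n"
    using mult_left_mono[OF vv B0] v2 n1 norm_ge_zero[of v]
    by (simp add: algebra_simps power2_eq_square)
  have kk: "(B * norm v + 1)\<^sup>2 \<le> (B + 1)\<^sup>2 * n"
  proof -
    have "(B + 1)\<^sup>2 * n - (B * norm v + 1)\<^sup>2
        = (B - norm v)\<^sup>2 + 2 * B * n"
      unfolding n_def by (simp add: power2_eq_square algebra_simps)
    moreover have "0 \<le> 2 * B * n" using B0 n1 by simp
    ultimately show ?thesis using zero_le_power2[of "B - norm v"] by linarith
  qed
  define \<Delta> where "\<Delta> = N' - N"
  have \<Delta>: "norm \<Delta> \<le> \<tau> * (1 + B * B)"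
  proof -
    have "norm \<Delta> \<le> norm (N' - N - \<tau> *\<^sub>R D) + norm (\<tau> *\<^sub>R D)"
      using norm_triangle_ineq[of "N' - N - \<tau> *\<^sub>R D" "\<tau> *\<^sub>R D"] unfolding \<Delta>_def by simp
    also have "\<dots> \<le> \<tau> * r + \<tau> * (B * B)"
      using R D \<tau>(1) by (intro add_mono) (auto simp: mult_left_mono)
    also have "\<dots> \<le> \<tau> * (1 + B * B)"
      using r \<tau>(1) by (simp add: algebra_simps mult_left_le)
    finally show ?thesis .
  qed
  have N': "norm N' \<le> 1 + B + B * B"
  proof -
    have "norm N' \<le> norm N + norm \<Delta>"
      using norm_triangle_ineq[of N \<Delta>] unfolding \<Delta>_def by simp
    also have "\<dots> \<le> B + 1 * (1 + B * B)"
      using N \<Delta> \<tau> \<delta> B0 mult_right_mono[of \<tau> 1 "1 + B * B"] by simp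
    finally show ?thesis by simp
  qed
  \<comment> \<open>Four remainders follow: the linearization error of the metric, the error
    \<open>e\<close> in the vector, the change of the metric paired with the increment, and the part
    quadratic in the increment. The last three account for the three summands of
    \<open>C\<close>.\<close>
  have 1: "v \<bullet> ((N' - N - \<tau> *\<^sub>R D) *v v) \<le> \<tau> * r * n"
  proof -
    have "v \<bullet> ((N' - N - \<tau> *\<^sub>R D) *v v) \<le> norm (N' - N - \<tau> *\<^sub>R D) * norm v * norm v"
      using inner_matrix_vector_le abs_le_D1 by blast
    also have "\<dots> \<le> (\<tau> * r) * n"
      using mult_mono[OF R vv] order_trans[OF norm_ge_zero R]
      by (simp add: mult.assoc power2_eq_square)
    finally show ?thesis .
  qed
  have 2: "2 * (v \<bullet> (N *v e)) \<le> \<tau> * (2 * B * \<delta>) * n"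
  proof -
    have "2 * (v \<bullet> (N *v e)) \<le> norm N * (2 * norm v) * norm e"
      using inner_matrix_vector_le[of v N e] by (simp add: abs_le_iff)
    also have "\<dots> \<le> B * n * (\<delta> * \<tau>)"
      using N v2 e B0 n1 by (intro mult_mono) auto
    also have "\<dots> \<le> 2 * (B * n * (\<delta> * \<tau>))"
      using B0 n1 \<tau> by simp
    finally show ?thesis by (simp add: mult_ac)
  qed
  have 3: "2 * (v \<bullet> (\<Delta> *v k)) \<le> \<tau> * (2 * (1 + B * B) * (B + 1) * \<delta>) * n"
  proof -
    have "2 * (v \<bullet> (\<Delta> *v k)) \<le> 2 * (norm \<Delta> * norm v * norm k)"
      using inner_matrix_vector_le[of v \<Delta> k] by (simp add: abs_le_iff)
    also have "\<dots> \<le> 2 * (\<tau> * (1 + B * B) * norm v * (\<tau> * (B * norm v + 1)))"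
      using \<Delta> k B0 \<tau> by (intro mult_left_mono mult_mono) auto
    also have "\<dots> = 2 * \<tau> * \<tau> * (1 + B * B) * (norm v * (B * norm v + 1))"
      by (simp add: mult_ac)
    also have "\<dots> \<le> 2 * \<tau> * \<delta> * (1 + B * B) * ((B + 1) * n)"
      using \<tau> B0 n1
      by (intro mult_mono[OF mult_right_mono[OF mult_left_mono] vk]) auto
    finally show ?thesis by (simp add: mult_ac)
  qed
  have 4: "k \<bullet> (N' *v k) \<le> \<tau> * ((1 + B + B * B) * (B + 1)\<^sup>2 * \<delta>) * n"
  proof -
    have "k \<bullet> (N' *v k) \<le> norm N' * norm k * norm k"
      using inner_matrix_vector_le abs_le_D1 by blast
    also have "\<dots> \<le> (1 + B + B * B) * (\<tau> * (B * norm v + 1)) * (\<tau> * (B * norm v + 1))"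
      using N' k B0 \<tau> by (intro mult_mono) auto
    also have "\<dots> = \<tau> * \<tau> * (1 + B + B * B) * (B * norm v + 1)\<^sup>2"
      by (simp add: power2_eq_square mult_ac)
    also have "\<dots> \<le> \<tau> * \<delta> * (1 + B + B * B) * ((B + 1)\<^sup>2 * n)"
      using \<tau> B0 n1
      by (intro mult_mono[OF mult_right_mono[OF mult_left_mono] kk]) auto
    finally show ?thesis by (simp add: mult_ac)
  qed
  have "w \<bullet> (N' *v w) = v \<bullet> (N' *v v) + 2 * (v \<bullet> (N' *v k)) + k \<bullet> (N' *v k)"
    unfolding w_def k_def[symmetric] by (rule symmetric_quadratic_add[OF sym])
  moreover have "v \<bullet> (N' *v v) = v \<bullet> (N *v v) + \<tau> * (v \<bullet> (D *v v)) + v \<bullet> ((N' - N - \<tau> *\<^sub>R D) *v v)"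
    by (simp add: matrix_vector_mult_diff_rdistrib inner_diff_right scaleR_matrix_vector_assoc[symmetric])
  moreover have "v \<bullet> (N' *v k) = v \<bullet> (N *v k) + v \<bullet> (\<Delta> *v k)"
    unfolding \<Delta>_def by (simp add: matrix_vector_mult_diff_rdistrib inner_diff_right)
  moreover have "v \<bullet> (N *v k) = \<tau> * (v \<bullet> (N *v (A *v v))) + v \<bullet> (N *v e)"
    unfolding k_def by (simp add: matrix_vector_right_distrib inner_add_right matrix_vector_mult_scaleR)
  ultimately have "w \<bullet> (N' *v w) \<le> v \<bullet> (N *v v) + \<tau> * (v \<bullet> (D *v v) + 2 * (v \<bullet> (N *v (A *v v))))
    + (\<tau> * r * n + \<tau> * (2 * B * \<delta>) * n + \<tau> * (2 * (1 + B * B) * (B + 1) * \<delta>) * n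
      + \<tau> * ((1 + B + B * B) * (B + 1)\<^sup>2 * \<delta>) * n)"
    using 1 2 3 4 by (simp add: distrib_left)
  also have "\<tau> * r * n + \<tau> * (2 * B * \<delta>) * n + \<tau> * (2 * (1 + B * B) * (B + 1) * \<delta>) * n
      + \<tau> * ((1 + B + B * B) * (B + 1)\<^sup>2 * \<delta>) * n = \<tau> * (r + C * \<delta>) * n"
    unfolding C_def by (simp add: distrib_left distrib_right)
  finally show ?thesis unfolding n_def .
qed

text \<open>The partial derivatives are uniformly continuous on the ball of radius
  \<open>R + 1\<close>, which contains the \<delta>-ball around each \<open>p\<close> because
  \<delta> \<le> 1. The mean value inequality applied to \<open>M\<close> minus its linear part then
  gives a bound uniform in \<open>p\<close>.\<close>

lemma metric_uniform_linearization:
  fixes M :: "real^'n \<Rightarrow> real^'n^'n"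
  assumes M: "bounded_metric M \<beta>\<^sub>0 \<beta>\<^sub>1" and "0 < \<eta>"
  obtains \<delta> where "0 < \<delta>"
    "\<And>p k. norm p \<le> R \<Longrightarrow> norm k \<le> \<delta> \<Longrightarrow>
      norm (M (p + k) - M p - (\<Sum>i\<in>UNIV. (k $ i) *\<^sub>R partial_deriv i M p)) \<le> \<eta> * norm k"
proof -
  \<comment> \<open>Collecting all partial derivatives in one function yields a single modulus for
    every index. The tolerance is divided by \<open>CARD('n)\<close> to offset the factor in
    \<open>norm_sum_scaleR_component_le\<close>.\<close>
  define P where "P = (\<lambda>p. \<chi> i::'n. partial_deriv i M p)"
  have "continuous_on UNIV (partial_deriv i M)" for i
    using M unfolding bounded_metric_def is_metric_def by auto
  then have "continuous_on (cball 0 (R + 1)) P"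
    unfolding P_def by (intro continuous_on_vec_lambda) (auto intro: continuous_on_subset)
  then obtain d where d: "0 < d"
      "\<And>p q. p \<in> cball 0 (R + 1) \<Longrightarrow> q \<in> cball 0 (R + 1) \<Longrightarrow> dist p q < d
        \<Longrightarrow> dist (P p) (P q) < \<eta> / CARD('n)"
    by (rule uniformly_continuous_modulus[where \<eta> = "\<eta> / CARD('n)"])
       (use \<open>0 < \<eta>\<close> in auto)
  define \<delta> where "\<delta> = min 1 (d / 2)"
  have "norm (M (p + k) - M p - (\<Sum>i\<in>UNIV. (k $ i) *\<^sub>R partial_deriv i M p)) \<le> \<eta> * norm k"
    if p: "norm p \<le> R" and k: "norm k \<le> \<delta>" for p k
  proof -
    let ?D = "\<lambda>x k. \<Sum>i\<in>UNIV. (k $ i) *\<^sub>R partial_deriv i M x"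
    have "norm (M (p + k) - M p - ?D p ((p + k) - p)) \<le> norm ((p + k) - p) * \<eta>"
    proof (rule differentiable_bound_linearization[where S = "cball p \<delta>" and f' = ?D])
      show "p + t *\<^sub>R (p + k - p) \<in> cball p \<delta>" if "t \<in> {0..1}" for t
        using that k mult_left_le_one_le[of "norm k" t] by (auto simp: dist_norm)
      show "(M has_derivative ?D x) (at x within cball p \<delta>)" for x
        using bounded_metric_has_derivative[OF M] has_derivative_at_withinI by blast
      show "p \<in> cball p \<delta>" using k norm_ge_zero[of k] by (auto simp del: norm_ge_zero)
      show "onorm (?D x - ?D p) \<le> \<eta>" if x: "x \<in> cball p \<delta>" for x
      proof (rule onorm_bound)
        fix u :: "real^'n"
        have "norm x \<le> norm p + dist p x"
          by (metis dist_commute dist_norm norm_triangle_sub)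
        then have "dist (P x) (P p) < \<eta> / CARD('n)"
          using x p d(1) by (intro d(2)) (auto simp: \<delta>_def dist_commute)
        then have *: "norm (partial_deriv i M x - partial_deriv i M p) \<le> \<eta> / CARD('n)" for i
          using Finite_Cartesian_Product.norm_nth_le[of "P x - P p" i] by (simp add: P_def dist_norm)
        have "(?D x - ?D p) u = (\<Sum>i\<in>UNIV. (u $ i) *\<^sub>R (partial_deriv i M x - partial_deriv i M p))"
          by (simp add: scaleR_diff_right sum_subtractf)
        also have "norm \<dots> \<le> real CARD('n) * (\<eta> / CARD('n)) * norm u"
          by (rule norm_sum_scaleR_component_le[OF *])
        finally show "norm ((?D x - ?D p) u) \<le> \<eta> * norm u" by simp
      qed (use \<open>0 < \<eta>\<close> in auto)
    qed
    then show ?thesis by (simp add: mult.commute)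
  qed
  moreover have "0 < \<delta>" using d(1) by (simp add: \<delta>_def)
  ultimately show ?thesis using that by blast
qed

text \<open>A point \<open>p\<close> and a tangent vector \<open>v\<close> are moved by one Euler
  step, with errors \<open>e\<close> and \<open>e'\<close> that leave room for later end point
  corrections. The contraction condition bounds the first-order term, and compactness makes \<delta>
  independent of \<open>p\<close>, \<open>t\<close> and \<open>v\<close>.\<close>

lemma euler_step_quadratic_form:
  fixes M :: "real^'n \<Rightarrow> real^'n^'n" and h :: "real^'n \<Rightarrow> real \<Rightarrow> real^'n"
  assumes h: "smooth_vector_field h" and M: "bounded_metric M \<beta>\<^sub>0 \<beta>\<^sub>1" and \<eta>: "0 < \<eta>"
  obtains \<delta> where "0 < \<delta>"
    "\<And>\<tau> t p v e e'. 0 \<le> \<tau> \<Longrightarrow> \<tau> \<le> \<delta> \<Longrightarrow> t \<in> {a..b} \<Longrightarrow> norm p \<le> R \<Longrightarrow>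
      norm e \<le> \<delta> * \<tau> \<Longrightarrow> norm e' \<le> \<delta> * \<tau> \<Longrightarrow> contraction_condition h M \<alpha> p t \<Longrightarrow>
      (v + (\<tau> *\<^sub>R (jacobian (\<lambda>y. h y t) (at p) *v v) + e')) \<bullet>
        (M (p + (\<tau> *\<^sub>R h p t + e)) *v (v + (\<tau> *\<^sub>R (jacobian (\<lambda>y. h y t) (at p) *v v) + e')))
      \<le> (1 - 2 * \<alpha> * \<tau>) * (v \<bullet> (M p *v v)) + \<eta> * \<tau> * (1 + (norm v)\<^sup>2)"
proof -
  define A where "A = (\<lambda>p t. jacobian (\<lambda>y. h y t) (at p))"
  define D where "D = (\<lambda>p k. \<Sum>i\<in>UNIV. (k $ i) *\<^sub>R partial_deriv i M p)"
  let ?K = "cball (0 :: real^'n) R" and ?S = "cball (0 :: real^'n) R \<times> {a..b}"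
  have cS: "compact ?S" by (intro compact_Times compact_cball) auto
  have "continuous_on ?S (\<lambda>(p, t). h p t)" "continuous_on ?S (\<lambda>(p, t). A p t)"
    using h unfolding smooth_vector_field_def A_def by (auto intro: continuous_on_subset)
  then have "bounded ((\<lambda>(p, t). h p t) ` ?S)" "bounded ((\<lambda>(p, t). A p t) ` ?S)"
    using cS by (auto intro!: compact_imp_bounded compact_continuous_image)
  then have "\<exists>B1. \<forall>p\<in>?K. \<forall>t\<in>{a..b}. norm (h p t) \<le> B1" "\<exists>B2. \<forall>p\<in>?K. \<forall>t\<in>{a..b}. norm (A p t) \<le> B2"
    unfolding bounded_iff by auto
  then obtain B1 B2 where B12: "\<And>p t. p \<in> ?K \<Longrightarrow> t \<in> {a..b} \<Longrightarrow> norm (h p t) \<le> B1"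
      "\<And>p t. p \<in> ?K \<Longrightarrow> t \<in> {a..b} \<Longrightarrow> norm (A p t) \<le> B2"
    by blast
  have "bounded (M ` ?K)"
    by (intro compact_imp_bounded compact_continuous_image compact_cball)
       (rule continuous_on_subset[OF bounded_metric_continuous[OF M]], simp)
  then obtain B3 where B3: "\<And>p. p \<in> ?K \<Longrightarrow> norm (M p) \<le> B3"
    unfolding bounded_iff by blast
  have "bounded ((\<lambda>p. \<chi> i::'n. partial_deriv i M p) ` ?K)"
    using M unfolding bounded_metric_def is_metric_def
    by (intro compact_imp_bounded compact_continuous_image compact_cball continuous_on_vec_lambda)
       (auto intro: continuous_on_subset)
  then obtain B4 where B4: "\<And>p. p \<in> ?K \<Longrightarrow> norm (\<chi> i::'n. partial_deriv i M p) \<le> B4"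
    unfolding bounded_iff by blast
  \<comment> \<open>One constant bounds the field, its Jacobian, the metric and the operator
    \<open>D p\<close> on the compact set.\<close>
  define B where "B = 1 + \<bar>B1\<bar> + \<bar>B2\<bar> + \<bar>B3\<bar> + real CARD('n) * \<bar>B4\<bar>"
  have B: "1 \<le> B" and BB: "B1 \<le> B" "B2 \<le> B" "B3 \<le> B" "real CARD('n) * \<bar>B4\<bar> \<le> B"
    unfolding B_def using mult_nonneg_nonneg[of "real CARD('n)" "\<bar>B4\<bar>"] by linarith+
  have D: "norm (D p k) \<le> B * norm k" if p: "p \<in> ?K" for p k
  proof -
    have "norm (partial_deriv i M p) \<le> \<bar>B4\<bar>" for i
      using Finite_Cartesian_Product.norm_nth_le[of "\<chi> i::'n. partial_deriv i M p" i] B4[OF p]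
      by simp
    then have "norm (D p k) \<le> real CARD('n) * \<bar>B4\<bar> * norm k"
      unfolding D_def by (rule norm_sum_scaleR_component_le)
    then show ?thesis using mult_right_mono[OF BB(4) norm_ge_zero[of k]] by linarith
  qed
  define C where "C = 2 * B + 2 * (1 + B * B) * (B + 1) + (1 + B + B * B) * (B + 1)\<^sup>2"
  define \<epsilon> where "\<epsilon> = min \<eta> 1 / 3"
  have C: "0 \<le> C" using B unfolding C_def by simp
  have \<epsilon>: "0 < \<epsilon>" "3 * \<epsilon> \<le> \<eta>" "3 * \<epsilon> \<le> 1" using \<eta> unfolding \<epsilon>_def by auto
  obtain d where d: "0 < d" "\<And>p k. norm p \<le> R \<Longrightarrow> norm k \<le> d \<Longrightarrow>
      norm (M (p + k) - M p - D p k) \<le> \<epsilon> / (B + 1) * norm k"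
    using metric_uniform_linearization[OF M, of "\<epsilon> / (B + 1)" R] \<epsilon>(1) B unfolding D_def by auto
  \<comment> \<open>The second bound keeps the displacement \<open>k\<close>, of norm at most
    \<open>(B + 1) * \<tau>\<close>, within the range \<open>d\<close> of the linearization. The
    third gives \<open>B * \<delta> + C * \<delta> \<le> \<epsilon>\<close>.\<close>
  define \<delta> where "\<delta> = min 1 (min (d / (B + 1)) (\<epsilon> / (B + C)))"
  have \<delta>: "0 < \<delta>" "\<delta> \<le> 1" using d(1) B C \<epsilon>(1) unfolding \<delta>_def by auto
  have "\<delta> \<le> d / (B + 1)" "\<delta> \<le> \<epsilon> / (B + C)" unfolding \<delta>_def by auto
  then have \<delta>d: "(B + 1) * \<delta> \<le> d" and \<delta>C: "B * \<delta> + C * \<delta> \<le> \<epsilon>"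
    using B C by (auto simp: field_simps)
  show ?thesis
  proof (rule that[OF \<delta>(1)])
    fix \<tau> t and p v e e' :: "real^'n"
    assume \<tau>: "0 \<le> \<tau>" "\<tau> \<le> \<delta>" and t: "t \<in> {a..b}" and p: "norm p \<le> R"
      and e: "norm e \<le> \<delta> * \<tau>" and e': "norm e' \<le> \<delta> * \<tau>"
      and con: "contraction_condition h M \<alpha> p t"
    have pK: "p \<in> ?K" using p by simp
    define k where "k = \<tau> *\<^sub>R h p t + e"
    let ?m = "metric_dot h M p t"
    have hB: "norm (h p t) \<le> B" using B12(1)[OF pK t] BB(1) by linarith
    have "norm e \<le> \<tau>" using e mult_right_mono[OF \<delta>(2) \<tau>(1)] by simp
    then have k: "norm k \<le> (B + 1) * \<tau>"
      unfolding k_def using norm_triangle_ineq[of "\<tau> *\<^sub>R h p t" e] mult_left_mono[OF hB \<tau>(1)] \<tau>(1)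
      by (simp add: algebra_simps)
    have kd: "norm k \<le> d"
      using k mult_left_mono[OF \<tau>(2), of "B + 1"] \<delta>d B by linarith
    have mD: "?m = D p (h p t)" unfolding metric_dot_def D_def ..
    have Dk: "D p k = \<tau> *\<^sub>R ?m + D p e"
      unfolding k_def mD D_def by (simp add: scaleR_left_distrib sum.distrib scaleR_sum_right)
    have "norm (M (p + k) - M p - \<tau> *\<^sub>R ?m) = norm (M (p + k) - M p - D p k + D p e)"
      unfolding Dk by (simp add: algebra_simps)
    also have "\<dots> \<le> \<epsilon> / (B + 1) * norm k + B * norm e"
      using d(2)[OF p kd] D[OF pK, of e] norm_triangle_ineq by (meson add_mono order_trans)
    also have "\<dots> \<le> \<epsilon> / (B + 1) * ((B + 1) * \<tau>) + B * (\<delta> * \<tau>)"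
      using k e \<epsilon>(1) B by (intro add_mono mult_left_mono) auto
    also have "\<dots> = \<tau> * (\<epsilon> + B * \<delta>)"
      using B by (simp add: field_simps)
    finally have rem: "norm (M (p + k) - M p - \<tau> *\<^sub>R ?m) \<le> \<tau> * (\<epsilon> + B * \<delta>)" .
    have C\<delta>: "0 \<le> C * \<delta>" using C \<delta>(1) by simp
    define w where "w = v + (\<tau> *\<^sub>R (A p t *v v) + e')"
    have "w \<bullet> (M (p + k) *v w)
        \<le> v \<bullet> (M p *v v) + \<tau> * (v \<bullet> (?m *v v) + 2 * (v \<bullet> (M p *v (A p t *v v))))
          + \<tau> * (\<epsilon> + B * \<delta> + C * \<delta>) * (1 + (norm v)\<^sup>2)"
      unfolding w_def C_def
    proof (rule quadratic_form_perturbation)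
      show "transpose (M (p + k)) = M (p + k)" by (rule bounded_metric_symmetric[OF M])
      show "norm (M p) \<le> B" using B3[OF pK] BB by linarith
      show "norm (A p t) \<le> B" using B12(2)[OF pK t] BB by linarith
      show "norm ?m \<le> B * B"
        using D[OF pK, of "h p t"] mult_left_mono[OF hB, of B] B unfolding mD by linarith
      show "\<epsilon> + B * \<delta> \<le> 1" using \<delta>C C\<delta> \<epsilon> by linarith
    qed (use rem e' \<tau> \<delta> in auto)
    also have "\<tau> * (v \<bullet> (?m *v v) + 2 * (v \<bullet> (M p *v (A p t *v v)))) \<le> \<tau> * (- 2 * \<alpha> * (v \<bullet> (M p *v v)))"
      using contraction_condition_quadratic[where M = M, OF bounded_metric_symmetric[OF M] con, of v] \<tau>(1)
      unfolding A_def by (rule mult_left_mono)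
    also have "\<tau> * (\<epsilon> + B * \<delta> + C * \<delta>) * (1 + (norm v)\<^sup>2) \<le> \<tau> * \<eta> * (1 + (norm v)\<^sup>2)"
      using \<delta>C \<epsilon> \<tau>(1) by (intro mult_right_mono mult_left_mono) auto
    finally show "(v + (\<tau> *\<^sub>R (jacobian (\<lambda>y. h y t) (at p) *v v) + e')) \<bullet>
        (M (p + (\<tau> *\<^sub>R h p t + e)) *v (v + (\<tau> *\<^sub>R (jacobian (\<lambda>y. h y t) (at p) *v v) + e')))
      \<le> (1 - 2 * \<alpha> * \<tau>) * (v \<bullet> (M p *v v)) + \<eta> * \<tau> * (1 + (norm v)\<^sup>2)"
      unfolding w_def k_def A_def by (simp add: algebra_simps)
  qed
qed

subsection \<open>Energy of curves\<close>

text \<open>The derivative is an explicit argument, so that the energy can refer to it directly; at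
  the end points it is one-sided.\<close>

definition C1_path :: "(real \<Rightarrow> 'a::euclidean_space) \<Rightarrow> (real \<Rightarrow> 'a) \<Rightarrow> 'a \<Rightarrow> 'a \<Rightarrow> bool"
  where "C1_path c c' x y \<longleftrightarrow> c 0 = x \<and> c 1 = y \<and> continuous_on {0..1} c' \<and>
    (\<forall>s\<in>{0..1}. (c has_vector_derivative c' s) (at s within {0..1}))"

text \<open>The Riemannian energy without the factor 1/2. Unlike for the length, a pointwise bound
  on the quadratic form integrates directly, with no square root.\<close>

definition energy :: "(real^'n \<Rightarrow> real^'n^'n) \<Rightarrow> (real \<Rightarrow> real^'n) \<Rightarrow> (real \<Rightarrow> real^'n) \<Rightarrow> real"
  where "energy M c c' = integral {0..1} (\<lambda>s. c' s \<bullet> (M (c s) *v c' s))"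

lemma C1_path_continuous: "C1_path c c' x y \<Longrightarrow> continuous_on {0..1} c"
  unfolding C1_path_def by (auto intro: continuous_on_vector_derivative)

text \<open>The displacement is at most the Euclidean length \<open>l\<close>, and on the unit
  interval the square of the length is at most the integral of the squared speed.\<close>

lemma C1_path_displacement:
  assumes c: "C1_path c c' x y" and s: "s \<in> {0..1}"
  shows "(norm (c s - x))\<^sup>2 \<le> integral {0..1} (\<lambda>s. (norm (c' s))\<^sup>2)"
proof -
  have cont: "continuous_on {0..1} c'" using c unfolding C1_path_def by auto
  define l where "l = integral {0..1} (\<lambda>s. norm (c' s))"
  have int1: "(\<lambda>s. norm (c' s)) integrable_on {0..1}" and int2: "(\<lambda>s. (norm (c' s))\<^sup>2) integrable_on {0..1}"
    using cont
    by (auto intro!: integrable_continuous_real continuous_on_norm continuous_on_power)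
  have "(c has_vector_derivative c' r) (at r within {0..s})" if "r \<in> {0..s}" for r
    using c s that unfolding C1_path_def
    by - (rule has_vector_derivative_within_subset[of c _ r "{0..1}"], auto)
  then have "(c' has_integral (c s - c 0)) {0..s}"
    using s by (intro fundamental_theorem_of_calculus[of 0 s c c']) simp_all
  then have "norm (c s - x) = norm (integral {0..s} c')"
    using c unfolding C1_path_def by (simp add: integral_unique)
  also have "\<dots> \<le> integral {0..s} (\<lambda>s. norm (c' s))"
  proof (intro integral_norm_bound_integral integrable_continuous_real continuous_on_norm)
    show "continuous_on {0..s} c'" "continuous_on {0..s} c'"
      using s by (auto intro: continuous_on_subset[OF cont])
  qed simp
  also have "\<dots> \<le> l"
    unfolding l_def using s int1
    by (intro integral_subset_le) (auto intro: integrable_on_subinterval)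
  finally have "norm (c s - x) \<le> l" .
  then have "(norm (c s - x))\<^sup>2 \<le> l\<^sup>2" by (intro power_mono) auto
  \<comment> \<open>Cauchy-Schwarz by integrating a square: the affine minorant
    \<open>2 * l * norm (c' s) - l\<^sup>2\<close> of the squared speed has integral
    \<open>l\<^sup>2\<close>.\<close>
  also have "l\<^sup>2 = integral {0..1} (\<lambda>s. 2 * l * norm (c' s) - l\<^sup>2)"
    by (subst integral_diff)
       (auto simp: l_def[symmetric] power2_eq_square intro!: int1 integrable_on_mult_right)
  also have "\<dots> \<le> integral {0..1} (\<lambda>s. (norm (c' s))\<^sup>2)"
  proof (intro integral_le int2)
    show "(\<lambda>s. 2 * l * norm (c' s) - l\<^sup>2) integrable_on {0..1}"
      using int1 by (intro integrable_diff integrable_on_mult_right integrable_const_ivl)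
    show "2 * l * norm (c' s) - l\<^sup>2 \<le> (norm (c' s))\<^sup>2" for s
      using zero_le_power2[of "norm (c' s) - l"] by (simp add: power2_diff mult_ac)
  qed
  finally show ?thesis .
qed

context
  fixes M :: "real^'n \<Rightarrow> real^'n^'n" and \<beta>\<^sub>0 \<beta>\<^sub>1 :: real
  assumes M: "bounded_metric M \<beta>\<^sub>0 \<beta>\<^sub>1"
begin

lemma energy_integrable:
  assumes "C1_path c c' x y"
  shows "(\<lambda>s. c' s \<bullet> (M (c s) *v c' s)) integrable_on {0..1}"
proof -
  have "continuous_on {0..1} (\<lambda>s. M (c s))"
    using bounded_metric_continuous[OF M] C1_path_continuous[OF assms]
    by (rule continuous_on_compose2) auto
  then show ?thesis
    using assms unfolding C1_path_def
    by (intro integrable_continuous_real continuous_intros) auto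
qed

lemma energy_lower:
  assumes "C1_path c c' x y"
  shows "\<beta>\<^sub>0\<^sup>2 * integral {0..1} (\<lambda>s. (norm (c' s))\<^sup>2) \<le> energy M c c'"
proof -
  have "(\<lambda>s. \<beta>\<^sub>0\<^sup>2 * (norm (c' s))\<^sup>2) integrable_on {0..1}"
    using assms unfolding C1_path_def by (intro integrable_continuous_real continuous_intros) auto
  then show ?thesis
    unfolding energy_def integral_mult_right[symmetric]
    using energy_integrable[OF assms] bounded_metric_lower[OF M] by (intro integral_le) auto
qed

text \<open>This holds at every point of the curve, not only at its end: a curve of small energy
  cannot leave a small ball around its starting point.\<close>

lemma energy_displacement:
  assumes "C1_path c c' x y" and "s \<in> {0..1}"
  shows "\<beta>\<^sub>0\<^sup>2 * (norm (c s - x))\<^sup>2 \<le> energy M c c'"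
  using energy_lower[OF assms(1)] mult_left_mono[OF C1_path_displacement[OF assms], of "\<beta>\<^sub>0\<^sup>2"] by simp

text \<open>The straight segment has constant velocity \<open>y - x\<close>; it serves as the
  initial curve.\<close>

lemma C1_path_linepath:
  obtains c c' where "C1_path c c' x y" "energy M c c' \<le> \<beta>\<^sub>1\<^sup>2 * (norm (x - y))\<^sup>2"
proof -
  define c where "c = (\<lambda>s. x + s *\<^sub>R (y - x))"
  have c: "C1_path c (\<lambda>_. y - x) x y"
    unfolding C1_path_def c_def by (auto intro!: derivative_eq_intros)
  have "energy M c (\<lambda>_. y - x) \<le> integral {0..1} (\<lambda>s::real. \<beta>\<^sub>1\<^sup>2 * (norm (y - x))\<^sup>2)"
    unfolding energy_def using energy_integrable[OF c] bounded_metric_upper[OF M]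
    by (intro integral_le) auto
  then show ?thesis using that[OF c] by (simp add: norm_minus_commute)
qed

end

subsection \<open>The contraction estimate\<close>

text \<open>Derivatives are one-sided at the end points. The condition is vacuous for
  \<open>b < a\<close>, so that \<open>forward_solution_iff\<close> can quantify over all
  \<open>T\<close>.\<close>

definition solution_on :: "(real^'n \<Rightarrow> real \<Rightarrow> real^'n) \<Rightarrow> (real \<Rightarrow> real^'n) \<Rightarrow> real \<Rightarrow> real \<Rightarrow> bool"
  where "solution_on h x a b \<longleftrightarrow>
    (\<forall>t\<in>{a..b}. (x has_vector_derivative h (x t) t) (at t within {a..b}))"

lemma solution_on_continuous: "solution_on h x a b \<Longrightarrow> continuous_on {a..b} x"
  unfolding solution_on_def by (auto intro: continuous_on_vector_derivative)

text \<open>The velocity \<open>h (x t) t\<close> is uniformly continuous on the compact interval,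
  so one step size serves all \<open>t\<close>.\<close>

lemma solution_on_euler_remainder:
  assumes h: "smooth_vector_field h" and x: "solution_on h x a b" and \<delta>: "0 < \<delta>"
  obtains \<tau>\<^sub>0 where "0 < \<tau>\<^sub>0"
    "\<And>t \<tau>. a \<le> t \<Longrightarrow> t + \<tau> \<le> b \<Longrightarrow> 0 \<le> \<tau> \<Longrightarrow> \<tau> \<le> \<tau>\<^sub>0 \<Longrightarrow>
      norm (x (t + \<tau>) - x t - \<tau> *\<^sub>R h (x t) t) \<le> \<delta> * \<tau>"
proof -
  have "continuous_on UNIV (\<lambda>(x, t). h x t)"
    using h unfolding smooth_vector_field_def by auto
  then have "continuous_on {a..b} (\<lambda>t. (\<lambda>(x, t). h x t) (x t, t))"
    by (rule continuous_on_compose2) (intro continuous_intros solution_on_continuous[OF x], simp)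
  then have "continuous_on {a..b} (\<lambda>t. h (x t) t)" by simp
  then obtain d where d: "0 < d"
    "\<And>s t. s \<in> {a..b} \<Longrightarrow> t \<in> {a..b} \<Longrightarrow> dist s t < d \<Longrightarrow> dist (h (x s) s) (h (x t) t) < \<delta>"
    by (rule uniformly_continuous_modulus) (use \<delta> in auto)
  have "norm (x (t + \<tau>) - x t - \<tau> *\<^sub>R h (x t) t) \<le> \<delta> * \<tau>"
    if t: "a \<le> t" "t + \<tau> \<le> b" and \<tau>: "0 \<le> \<tau>" "\<tau> \<le> d / 2" for t \<tau>
  proof -
    have "norm (x (t + \<tau>) - x t - (t + \<tau> - t) *\<^sub>R h (x t) t) \<le> norm (t + \<tau> - t) * \<delta>"
    proof (rule vector_differentiable_bound_linearization[where S = "{t..t + \<tau>}"])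
      show "(x has_vector_derivative h (x s) s) (at s within {t..t + \<tau>})" if "s \<in> {t..t + \<tau>}" for s
        using x t that unfolding solution_on_def
        by - (rule has_vector_derivative_within_subset[of x _ s "{a..b}"], auto)
      show "norm (h (x s) s - h (x t) t) \<le> \<delta>" if "s \<in> {t..t + \<tau>}" for s
        using d(2)[of s t] d(1) t \<tau> that by (auto simp: dist_norm less_imp_le)
    qed (use \<tau> in \<open>auto simp: closed_segment_eq_real_ivl\<close>)
    then show ?thesis using \<tau>(1) by (simp add: mult.commute)
  qed
  then show ?thesis using that[of "d / 2"] d(1) by auto
qed

text \<open>The bound for one Euler step of a tangent vector, integrated along the curve. The points
  \<open>x'\<close> and \<open>y'\<close> are to be the positions of the two solutions at time
  \<open>t + \<tau>\<close>.\<close>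

lemma euler_step_path:
  fixes M :: "real^'n \<Rightarrow> real^'n^'n" and h :: "real^'n \<Rightarrow> real \<Rightarrow> real^'n"
  assumes h: "smooth_vector_field h" and M: "bounded_metric M \<beta>\<^sub>0 \<beta>\<^sub>1" and \<eta>: "0 < \<eta>"
  obtains \<delta> where "0 < \<delta>"
    "\<And>\<tau> t c c' x y x' y'. 0 \<le> \<tau> \<Longrightarrow> \<tau> \<le> \<delta> \<Longrightarrow> t \<in> {a..b} \<Longrightarrow> C1_path c c' x y \<Longrightarrow>
      (\<And>s. s \<in> {0..1} \<Longrightarrow> norm (c s) \<le> R) \<Longrightarrow>
      (\<And>s. s \<in> {0..1} \<Longrightarrow> contraction_condition h M \<alpha> (c s) t) \<Longrightarrow>
      norm (x' - x - \<tau> *\<^sub>R h x t) \<le> \<delta> * \<tau> \<Longrightarrow> norm (y' - y - \<tau> *\<^sub>R h y t) \<le> \<delta> * \<tau> \<Longrightarrow>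
      \<exists>c2 c2'. C1_path c2 c2' x' y' \<and>
        energy M c2 c2' \<le> (1 - 2 * \<alpha> * \<tau>) * energy M c c'
          + \<eta> * \<tau> * (1 + integral {0..1} (\<lambda>s. (norm (c' s))\<^sup>2))"
proof -
  obtain d where d: "0 < d"
    "\<And>\<tau> t p v e e'. 0 \<le> \<tau> \<Longrightarrow> \<tau> \<le> d \<Longrightarrow> t \<in> {a..b} \<Longrightarrow> norm p \<le> R \<Longrightarrow>
      norm e \<le> d * \<tau> \<Longrightarrow> norm e' \<le> d * \<tau> \<Longrightarrow> contraction_condition h M \<alpha> p t \<Longrightarrow>
      (v + (\<tau> *\<^sub>R (jacobian (\<lambda>y. h y t) (at p) *v v) + e')) \<bullet>
        (M (p + (\<tau> *\<^sub>R h p t + e)) *v (v + (\<tau> *\<^sub>R (jacobian (\<lambda>y. h y t) (at p) *v v) + e')))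
      \<le> (1 - 2 * \<alpha> * \<tau>) * (v \<bullet> (M p *v v)) + \<eta> * \<tau> * (1 + (norm v)\<^sup>2)"
    using euler_step_quadratic_form[OF h M \<eta>, where a = a and b = b and R = R and \<alpha> = \<alpha>] by blast
  have "\<exists>c2 c2'. C1_path c2 c2' x' y' \<and>
        energy M c2 c2' \<le> (1 - 2 * \<alpha> * \<tau>) * energy M c c'
          + \<eta> * \<tau> * (1 + integral {0..1} (\<lambda>s. (norm (c' s))\<^sup>2))"
    if \<tau>: "0 \<le> \<tau>" "\<tau> \<le> d / 2" and t: "t \<in> {a..b}" and c: "C1_path c c' x y"
      and R: "\<And>s. s \<in> {0..1} \<Longrightarrow> norm (c s) \<le> R"
      and con: "\<And>s. s \<in> {0..1} \<Longrightarrow> contraction_condition h M \<alpha> (c s) t"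
      and x': "norm (x' - x - \<tau> *\<^sub>R h x t) \<le> d / 2 * \<tau>"
      and y': "norm (y' - y - \<tau> *\<^sub>R h y t) \<le> d / 2 * \<tau>" for \<tau> t c c' x y x' y'
  proof -
    define e0 where "e0 = x' - x - \<tau> *\<^sub>R h x t"
    define e1 where "e1 = y' - y - \<tau> *\<^sub>R h y t"
    define A where "A = (\<lambda>p. jacobian (\<lambda>y. h y t) (at p))"
    \<comment> \<open>The end point errors are interpolated linearly, so the new curve ends exactly
      at \<open>x'\<close> and \<open>y'\<close>, and its velocity gains the constant
      \<open>e1 - e0\<close>. Each error is allowed only \<open>d / 2 * \<tau>\<close>, so that this
      difference stays within \<open>d * \<tau>\<close>.\<close>
    define e where "e = (\<lambda>s. (1 - s) *\<^sub>R e0 + s *\<^sub>R e1)"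
    define c2 where "c2 = (\<lambda>s. c s + (\<tau> *\<^sub>R h (c s) t + e s))"
    define c2' where "c2' = (\<lambda>s. c' s + (\<tau> *\<^sub>R (A (c s) *v c' s) + (e1 - e0)))"
    have cc: "continuous_on {0..1} c" by (rule C1_path_continuous[OF c])
    have c': "continuous_on {0..1} c'" using c unfolding C1_path_def by auto
    have "continuous_on UNIV (\<lambda>(x, t). jacobian (\<lambda>y. h y t) (at x))"
      using h unfolding smooth_vector_field_def by auto
    then have "continuous_on {0..1} (\<lambda>s. (\<lambda>(x, t). jacobian (\<lambda>y. h y t) (at x)) (c s, t))"
      by (rule continuous_on_compose2) (intro continuous_intros cc, simp)
    then have "continuous_on {0..1} (\<lambda>s. A (c s))" unfolding A_def by simp
    then have cont': "continuous_on {0..1} c2'"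
      unfolding c2'_def by (intro continuous_intros c')
    have "(c2 has_vector_derivative c2' s) (at s within {0..1})" if s: "s \<in> {0..1}" for s
    proof -
      have dc: "(c has_vector_derivative c' s) (at s within {0..1})"
        using c s unfolding C1_path_def by auto
      have "((\<lambda>y. h y t) has_derivative (*v) (A (c s))) (at (c s))"
        using h unfolding smooth_vector_field_def A_def by (simp add: jacobian_works)
      then have "((\<lambda>y. h y t) \<circ> c has_vector_derivative A (c s) *v c' s) (at s within {0..1})"
        by (intro vector_derivative_diff_chain_within[OF dc]) (rule has_derivative_at_withinI)
      then have "((\<lambda>s. h (c s) t) has_vector_derivative A (c s) *v c' s) (at s within {0..1})"
        by (simp add: o_def)
      then show ?thesis
        unfolding c2_def c2'_def e_def
        by (auto intro!: derivative_eq_intros dc)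
    qed
    then have c2: "C1_path c2 c2' x' y'"
      using c cont' unfolding C1_path_def c2_def e_def e0_def e1_def by auto
    have int: "(\<lambda>s. (norm (c' s))\<^sup>2) integrable_on {0..1}"
      by (intro integrable_continuous_real continuous_intros c')
    have "energy M c2 c2' \<le> integral {0..1}
      (\<lambda>s. (1 - 2 * \<alpha> * \<tau>) * (c' s \<bullet> (M (c s) *v c' s)) + \<eta> * \<tau> * (1 + (norm (c' s))\<^sup>2))"
      unfolding energy_def
    proof (rule integral_le[OF energy_integrable[OF M c2]])
      show "(\<lambda>s. (1 - 2 * \<alpha> * \<tau>) * (c' s \<bullet> (M (c s) *v c' s)) + \<eta> * \<tau> * (1 + (norm (c' s))\<^sup>2))
          integrable_on {0..1}"
        using energy_integrable[OF M c] int
        by (intro integrable_add integrable_on_mult_right integrable_const_ivl)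
      fix s :: real assume s: "s \<in> {0..1}"
      have d\<tau>: "0 \<le> d * \<tau>" using d(1) \<tau>(1) by simp
      have e01: "norm e0 \<le> d * \<tau>" "norm e1 \<le> d * \<tau>"
        using x' y' d\<tau> unfolding e0_def e1_def by simp_all
      have "norm (e s) \<le> (1 - s) * norm e0 + s * norm e1"
        unfolding e_def using s norm_triangle_ineq[of "(1 - s) *\<^sub>R e0" "s *\<^sub>R e1"] by simp
      also have "\<dots> \<le> (1 - s) * (d * \<tau>) + s * (d * \<tau>)"
        using s e01 by (intro add_mono mult_left_mono) auto
      finally have es: "norm (e s) \<le> d * \<tau>" by (simp add: algebra_simps)
      have "norm (e1 - e0) \<le> d * \<tau>"
        using x' y' norm_triangle_ineq4[of e1 e0] unfolding e0_def[symmetric] e1_def[symmetric] by simp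
      with es show "c2' s \<bullet> (M (c2 s) *v c2' s)
          \<le> (1 - 2 * \<alpha> * \<tau>) * (c' s \<bullet> (M (c s) *v c' s)) + \<eta> * \<tau> * (1 + (norm (c' s))\<^sup>2)"
        unfolding c2'_def c2_def A_def using s \<tau> t d(1) by (intro d(2) R con) auto
    qed
    also have "\<dots> = (1 - 2 * \<alpha> * \<tau>) * energy M c c' + \<eta> * \<tau> * (1 + integral {0..1} (\<lambda>s. (norm (c' s))\<^sup>2))"
    proof -
      have "integral {0..1} (\<lambda>s. 1 + (norm (c' s))\<^sup>2) = 1 + integral {0..1} (\<lambda>s. (norm (c' s))\<^sup>2)"
        using int by (subst integral_add) auto
      moreover have "(\<lambda>s. 1 + (norm (c' s))\<^sup>2) integrable_on {0..1}"
        using int by (intro integrable_add integrable_const_ivl)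
      ultimately show ?thesis
        using energy_integrable[OF M c] unfolding energy_def
        by (subst integral_add) (simp_all add: integrable_on_mult_right)
    qed
    finally show ?thesis using c2 by blast
  qed
  then show ?thesis using that[of "d / 2"] d(1) by simp
qed

text \<open>Euler steps are iterated on a fine partition. By \<open>small\<close> the energies never
  reach \<open>\<beta>\<^sub>0\<^sup>2 * \<rho>\<^sup>2\<close>, so every curve stays in the
  \<rho>-tube around \<open>x\<close>, where the contraction condition is known; \<epsilon> absorbs
  the accumulated error.\<close>

lemma contraction_estimate_approx:
  fixes M :: "real^'n \<Rightarrow> real^'n^'n" and h :: "real^'n \<Rightarrow> real \<Rightarrow> real^'n"
  assumes h: "smooth_vector_field h" and M: "bounded_metric M \<beta>\<^sub>0 \<beta>\<^sub>1" and \<alpha>: "0 \<le> \<alpha>"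
    and x: "solution_on h x a b" and y: "solution_on h y a b" and ab: "a \<le> b"
    and con: "\<And>t p. t \<in> {a..b} \<Longrightarrow> p \<in> ball (x t) \<rho> \<Longrightarrow> contraction_condition h M \<alpha> p t"
    and \<rho>: "0 < \<rho>" and \<epsilon>: "0 < \<epsilon>"
    and small: "\<beta>\<^sub>1\<^sup>2 * (norm (x a - y a))\<^sup>2 + \<epsilon> < \<beta>\<^sub>0\<^sup>2 * \<rho>\<^sup>2"
  shows "\<beta>\<^sub>0\<^sup>2 * (norm (x b - y b))\<^sup>2 \<le> exp (- 2 * \<alpha> * (b - a)) * (\<beta>\<^sub>1\<^sup>2 * (norm (x a - y a))\<^sup>2) + \<epsilon>"
proof -
  define E where "E = \<beta>\<^sub>1\<^sup>2 * (norm (x a - y a))\<^sup>2"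
  have E: "0 \<le> E" unfolding E_def by simp
  \<comment> \<open>The integral of the squared speed will stay below \<open>\<rho>\<^sup>2\<close>,
    so a step costs at most \<open>\<eta> * \<tau> * (1 + \<rho>\<^sup>2)\<close>, that is, \<mu>
    per unit of time. The choice of \<eta> makes the total at most \<epsilon>; the
    \<open>+ 1\<close> keeps the denominator positive when \<open>a = b\<close>.\<close>
  define \<eta> where "\<eta> = \<epsilon> / ((1 + \<rho>\<^sup>2) * (b - a + 1))"
  have pos: "0 < (1 + \<rho>\<^sup>2) * (b - a + 1)" using ab by (simp add: add_pos_nonneg)
  then have \<eta>: "0 < \<eta>" using \<epsilon> unfolding \<eta>_def by simp
  define \<mu> where "\<mu> = \<eta> * (1 + \<rho>\<^sup>2)"
  have \<mu>: "0 \<le> \<mu>" using \<eta> unfolding \<mu>_def by simp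
  have "\<mu> * (b - a + 1) = \<eta> * ((1 + \<rho>\<^sup>2) * (b - a + 1))" unfolding \<mu>_def by (simp only: mult.assoc)
  also have "\<dots> = \<epsilon>" using pos \<eta>_def by (metis less_irrefl nonzero_eq_divide_eq)
  finally have "\<mu> * (b - a + 1) = \<epsilon>" .
  then have \<mu>\<epsilon>: "\<mu> * (b - a) \<le> \<epsilon>" using \<mu> by (simp add: algebra_simps)
  have "bounded (x ` {a..b})"
    by (intro compact_imp_bounded compact_continuous_image solution_on_continuous[OF x]) auto
  then obtain r where r: "\<And>t. t \<in> {a..b} \<Longrightarrow> norm (x t) \<le> r" unfolding bounded_iff by blast
  obtain \<delta> where \<delta>: "0 < \<delta>"
    "\<And>\<tau> t c c' x y x' y'. 0 \<le> \<tau> \<Longrightarrow> \<tau> \<le> \<delta> \<Longrightarrow> t \<in> {a..b} \<Longrightarrow> C1_path c c' x y \<Longrightarrow>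
      (\<And>s. s \<in> {0..1} \<Longrightarrow> norm (c s) \<le> r + \<rho>) \<Longrightarrow>
      (\<And>s. s \<in> {0..1} \<Longrightarrow> contraction_condition h M \<alpha> (c s) t) \<Longrightarrow>
      norm (x' - x - \<tau> *\<^sub>R h x t) \<le> \<delta> * \<tau> \<Longrightarrow> norm (y' - y - \<tau> *\<^sub>R h y t) \<le> \<delta> * \<tau> \<Longrightarrow>
      \<exists>c2 c2'. C1_path c2 c2' x' y' \<and>
        energy M c2 c2' \<le> (1 - 2 * \<alpha> * \<tau>) * energy M c c'
          + \<eta> * \<tau> * (1 + integral {0..1} (\<lambda>s. (norm (c' s))\<^sup>2))"
    using euler_step_path[OF h M \<eta>, where a = a and b = b and R = "r + \<rho>" and \<alpha> = \<alpha>] by blast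
  obtain d1 where d1: "0 < d1" "\<And>t \<tau>. a \<le> t \<Longrightarrow> t + \<tau> \<le> b \<Longrightarrow> 0 \<le> \<tau> \<Longrightarrow> \<tau> \<le> d1 \<Longrightarrow>
      norm (x (t + \<tau>) - x t - \<tau> *\<^sub>R h (x t) t) \<le> \<delta> * \<tau>"
    using solution_on_euler_remainder[OF h x \<delta>(1)] by blast
  obtain d2 where d2: "0 < d2" "\<And>t \<tau>. a \<le> t \<Longrightarrow> t + \<tau> \<le> b \<Longrightarrow> 0 \<le> \<tau> \<Longrightarrow> \<tau> \<le> d2 \<Longrightarrow>
      norm (y (t + \<tau>) - y t - \<tau> *\<^sub>R h (y t) t) \<le> \<delta> * \<tau>"
    using solution_on_euler_remainder[OF h y \<delta>(1)] by blast
  define m where "m = min \<delta> (min d1 d2)"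
  have m: "0 < m" using \<delta>(1) d1(1) d2(1) unfolding m_def by simp
  \<comment> \<open>The strict inequality forces \<open>N\<close> to be positive even when
    \<open>a = b\<close>.\<close>
  obtain N :: nat where N: "(b - a) / m < real N" using reals_Archimedean2 by blast
  then have N0: "0 < real N" using ab m by (meson divide_nonneg_pos diff_ge_0_iff_ge le_less_trans)
  define \<tau> where "\<tau> = (b - a) / N"
  have \<tau>0: "0 \<le> \<tau>" using ab N0 unfolding \<tau>_def by simp
  have "\<tau> \<le> m" using N N0 m unfolding \<tau>_def by (simp add: field_simps)
  then have \<tau>m: "\<tau> \<le> \<delta>" "\<tau> \<le> d1" "\<tau> \<le> d2" unfolding m_def by auto
  have N\<tau>: "real N * \<tau> = b - a" using N0 unfolding \<tau>_def by simp
  \<comment> \<open>Invariant after \<open>k\<close> steps: the initial energy bound is discounted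
    exponentially, while the errors add up linearly in time.\<close>
  have "\<exists>c c'. C1_path c c' (x (a + real k * \<tau>)) (y (a + real k * \<tau>)) \<and>
      energy M c c' \<le> exp (- 2 * \<alpha> * (real k * \<tau>)) * E + \<mu> * (real k * \<tau>)" if "k \<le> N" for k
    using that
  proof (induction k)
    case 0
    obtain c c' where "C1_path c c' (x a) (y a)" "energy M c c' \<le> E"
      unfolding E_def by (rule C1_path_linepath[OF M])
    then show ?case by auto
  next
    case (Suc k)
    define t where "t = a + real k * \<tau>"
    have k: "real k * \<tau> + \<tau> \<le> b - a"
      using mult_right_mono[OF _ \<tau>0, of "real (Suc k)" "real N"] Suc.prems N\<tau>
      by (simp add: algebra_simps)
    have t: "t \<in> {a..b}" "t + \<tau> \<le> b" using k \<tau>0 unfolding t_def by auto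
    have tS: "a + real (Suc k) * \<tau> = t + \<tau>" unfolding t_def by (simp add: algebra_simps)
    obtain c c' where c: "C1_path c c' (x t) (y t)"
      and Ec: "energy M c c' \<le> exp (- 2 * \<alpha> * (real k * \<tau>)) * E + \<mu> * (real k * \<tau>)"
      using Suc unfolding t_def by auto
    have "exp (- 2 * \<alpha> * (real k * \<tau>)) * E \<le> 1 * E"
      using \<alpha> \<tau>0 E by (intro mult_right_mono) auto
    moreover have "\<mu> * (real k * \<tau>) \<le> \<mu> * (b - a)" using k \<tau>0 \<mu> by (intro mult_left_mono) auto
    \<comment> \<open>The bootstrap: the invariant keeps the energy below the threshold, hence the
      curve in the tube, hence the next step is admissible.\<close>
    ultimately have Ebd: "energy M c c' < \<beta>\<^sub>0\<^sup>2 * \<rho>\<^sup>2"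
      using Ec \<mu>\<epsilon> small unfolding E_def by linarith
    have near: "norm (c s - x t) < \<rho>" if "s \<in> {0..1}" for s
    proof -
      have "\<beta>\<^sub>0\<^sup>2 * (norm (c s - x t))\<^sup>2 < \<beta>\<^sub>0\<^sup>2 * \<rho>\<^sup>2"
        using energy_displacement[OF M c that] Ebd by linarith
      then have "(norm (c s - x t))\<^sup>2 < \<rho>\<^sup>2"
        using bounded_metric_lower_pos[OF M] by simp
      then show ?thesis using \<rho> by (simp add: power_less_imp_less_base)
    qed
    have "\<beta>\<^sub>0\<^sup>2 * integral {0..1} (\<lambda>s. (norm (c' s))\<^sup>2) < \<beta>\<^sub>0\<^sup>2 * \<rho>\<^sup>2"
      using energy_lower[OF M c] Ebd by linarith
    then have I: "integral {0..1} (\<lambda>s. (norm (c' s))\<^sup>2) \<le> \<rho>\<^sup>2"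
      using bounded_metric_lower_pos[OF M] by simp
    have "\<exists>c2 c2'. C1_path c2 c2' (x (t + \<tau>)) (y (t + \<tau>)) \<and>
        energy M c2 c2' \<le> (1 - 2 * \<alpha> * \<tau>) * energy M c c'
          + \<eta> * \<tau> * (1 + integral {0..1} (\<lambda>s. (norm (c' s))\<^sup>2))"
    proof (rule \<delta>(2)[OF \<tau>0 \<tau>m(1) t(1) c])
      show "norm (c s) \<le> r + \<rho>" if "s \<in> {0..1}" for s
        using near[OF that] r[OF t(1)] norm_triangle_ineq[of "x t" "c s - x t"] by simp
      show "contraction_condition h M \<alpha> (c s) t" if "s \<in> {0..1}" for s
        using near[OF that] by (intro con[OF t(1)]) (simp add: dist_norm norm_minus_commute)
    qed (use d1(2)[of t \<tau>] d2(2)[of t \<tau>] t \<tau>0 \<tau>m in auto)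
    then obtain c2 c2' where c2: "C1_path c2 c2' (x (t + \<tau>)) (y (t + \<tau>))"
      and E2: "energy M c2 c2' \<le> (1 - 2 * \<alpha> * \<tau>) * energy M c c'
          + \<eta> * \<tau> * (1 + integral {0..1} (\<lambda>s. (norm (c' s))\<^sup>2))" by blast
    have E0: "0 \<le> energy M c c'"
      using energy_displacement[OF M c, of 0] by (auto intro: order_trans[rotated])
    \<comment> \<open>The inequality \<open>1 + u \<le> exp u\<close> turns the Euler factor into an
      exponential; it requires only that the energy is nonnegative.\<close>
    have "(1 - 2 * \<alpha> * \<tau>) * energy M c c' \<le> exp (- 2 * \<alpha> * \<tau>) * energy M c c'"
      using exp_ge_add_one_self[of "- 2 * \<alpha> * \<tau>"] E0 by (intro mult_right_mono) auto
    also have "\<dots> \<le> exp (- 2 * \<alpha> * \<tau>) * (exp (- 2 * \<alpha> * (real k * \<tau>)) * E + \<mu> * (real k * \<tau>))"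
      using Ec by (intro mult_left_mono) auto
    also have "\<dots> \<le> exp (- 2 * \<alpha> * (real (Suc k) * \<tau>)) * E + 1 * (\<mu> * (real k * \<tau>))"
    proof -
      have "exp (- 2 * \<alpha> * \<tau>) * exp (- 2 * \<alpha> * (real k * \<tau>)) = exp (- 2 * \<alpha> * (real (Suc k) * \<tau>))"
        by (simp add: algebra_simps flip: exp_add)
      moreover have "exp (- 2 * \<alpha> * \<tau>) * (\<mu> * (real k * \<tau>)) \<le> 1 * (\<mu> * (real k * \<tau>))"
        using \<alpha> \<tau>0 \<mu> by (intro mult_right_mono) auto
      ultimately show ?thesis by (simp add: distrib_left flip: mult.assoc)
    qed
    finally have "(1 - 2 * \<alpha> * \<tau>) * energy M c c'
        \<le> exp (- 2 * \<alpha> * (real (Suc k) * \<tau>)) * E + \<mu> * (real k * \<tau>)" by simp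
    moreover have "\<eta> * \<tau> * (1 + integral {0..1} (\<lambda>s. (norm (c' s))\<^sup>2)) \<le> \<eta> * \<tau> * (1 + \<rho>\<^sup>2)"
      using I \<eta> \<tau>0 by (intro mult_left_mono) auto
    moreover have "\<mu> * (real k * \<tau>) + \<eta> * \<tau> * (1 + \<rho>\<^sup>2) = \<mu> * (real (Suc k) * \<tau>)"
      unfolding \<mu>_def by (simp add: algebra_simps)
    ultimately have "energy M c2 c2' \<le> exp (- 2 * \<alpha> * (real (Suc k) * \<tau>)) * E + \<mu> * (real (Suc k) * \<tau>)"
      using E2 by linarith
    then show ?case using c2 unfolding tS by blast
  qed
  from this[of N] obtain c c' where c: "C1_path c c' (x b) (y b)"
    and "energy M c c' \<le> exp (- 2 * \<alpha> * (b - a)) * E + \<mu> * (b - a)"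
    unfolding N\<tau> by auto
  moreover have "\<beta>\<^sub>0\<^sup>2 * (norm (y b - x b))\<^sup>2 \<le> energy M c c'"
    using energy_displacement[OF M c, of 1] c unfolding C1_path_def by auto
  ultimately show ?thesis using \<mu>\<epsilon> unfolding E_def by (simp add: norm_minus_commute)
qed

text \<open>The error of the approximate estimate is arbitrary. As \<open>small\<close> is strict,
  half of its gap can be spent on the error.\<close>

theorem contraction_estimate:
  fixes M :: "real^'n \<Rightarrow> real^'n^'n" and h :: "real^'n \<Rightarrow> real \<Rightarrow> real^'n"
  assumes h: "smooth_vector_field h" and M: "bounded_metric M \<beta>\<^sub>0 \<beta>\<^sub>1" and \<alpha>: "0 \<le> \<alpha>"
    and x: "solution_on h x a b" and y: "solution_on h y a b" and ab: "a \<le> b"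
    and con: "\<And>t p. t \<in> {a..b} \<Longrightarrow> p \<in> ball (x t) \<rho> \<Longrightarrow> contraction_condition h M \<alpha> p t"
    and \<rho>: "0 < \<rho>" and small: "\<beta>\<^sub>1\<^sup>2 * (norm (x a - y a))\<^sup>2 < \<beta>\<^sub>0\<^sup>2 * \<rho>\<^sup>2"
  shows "\<beta>\<^sub>0\<^sup>2 * (norm (x b - y b))\<^sup>2 \<le> exp (- 2 * \<alpha> * (b - a)) * (\<beta>\<^sub>1\<^sup>2 * (norm (x a - y a))\<^sup>2)"
proof (rule field_le_epsilon)
  fix e :: real assume e: "0 < e"
  define \<epsilon> where "\<epsilon> = min e ((\<beta>\<^sub>0\<^sup>2 * \<rho>\<^sup>2 - \<beta>\<^sub>1\<^sup>2 * (norm (x a - y a))\<^sup>2) / 2)"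
  have "0 < \<epsilon>" "\<epsilon> \<le> e" "\<beta>\<^sub>1\<^sup>2 * (norm (x a - y a))\<^sup>2 + \<epsilon> < \<beta>\<^sub>0\<^sup>2 * \<rho>\<^sup>2"
    using e small unfolding \<epsilon>_def by (auto simp: min_def field_simps)
  from contraction_estimate_approx[OF h M \<alpha> x y ab con \<rho> this(1,3)] this(2)
  show "\<beta>\<^sub>0\<^sup>2 * (norm (x b - y b))\<^sup>2
      \<le> exp (- 2 * \<alpha> * (b - a)) * (\<beta>\<^sub>1\<^sup>2 * (norm (x a - y a))\<^sup>2) + e"
    by simp
qed

subsection \<open>Existence of solutions\<close>

text \<open>Integrating the exponential weight gains a factor \<open>1 / K\<close>, the source of
  the contraction constant in the Picard iteration.\<close>

lemma integral_exp_affine: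
  fixes K a t :: real
  assumes "a \<le> t" "0 < K"
  shows "((\<lambda>s. exp (K * (s - a))) has_integral (exp (K * (t - a)) - 1) / K) {a..t}"
proof -
  have "((\<lambda>s. exp (K * (s - a)) / K) has_vector_derivative exp (K * (s - a))) (at s within {a..t})" for s
    using assms(2) unfolding has_real_derivative_iff_has_vector_derivative[symmetric]
    by (auto intro!: derivative_eq_intros)
  from fundamental_theorem_of_calculus[OF assms(1) this] show ?thesis
    by (simp add: diff_divide_distrib)
qed

text \<open>Picard iteration is run on \<open>exp (- K (t - a)) z t\<close>: with this weight the integral operator is
  a contraction on the whole interval at once.\<close>

lemma lipschitz_ode_solution_exists:
  fixes g :: "'a::euclidean_space \<Rightarrow> real \<Rightarrow> 'a"
  assumes ab: "a \<le> b" and cont: "continuous_on (UNIV \<times> {a..b}) (\<lambda>(x, t). g x t)"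
    and L: "0 \<le> L" and lip: "\<And>t x y. t \<in> {a..b} \<Longrightarrow> norm (g x t - g y t) \<le> L * norm (x - y)"
  obtains z where "z a = x0"
    "\<And>t. t \<in> {a..b} \<Longrightarrow> (z has_vector_derivative g (z t) t) (at t within {a..b})"
proof -
  \<comment> \<open>This makes \<open>L / K\<close> at most 1/2, and keeps \<open>K\<close> positive
    when \<open>L = 0\<close>.\<close>
  define K where "K = 2 * L + 1"
  have K: "0 < K" "L / K \<le> 1 / 2" using L unfolding K_def by (auto simp: field_simps)
  define Z where "Z = (\<lambda>(u :: real \<Rightarrow>\<^sub>C 'a) s. exp (K * (s - a)) *\<^sub>R apply_bcontfun u s)"
  define G where "G = (\<lambda>u s. g (Z u s) s)"
  define F where "F = (\<lambda>u t. exp (- K * (t - a)) *\<^sub>R (x0 + integral {a..t} (G u)))"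
  \<comment> \<open>Clamping time to \<open>{a..b}\<close> extends \<open>F u\<close> to a bounded
    continuous function on the whole line, so that Banach's theorem applies in the complete space of
    such functions.\<close>
  define cl where "cl = (\<lambda>t. max a (min b t))"
  have cl: "cl t \<in> {a..b}" for t using ab unfolding cl_def by auto
  have cl_id: "cl t = t" if "t \<in> {a..b}" for t using that unfolding cl_def by auto
  have G: "continuous_on {a..b} (G u)" for u
  proof -
    have "continuous_on {a..b} (\<lambda>s. (\<lambda>(x, t). g x t) (Z u s, s))"
      unfolding Z_def
      by (rule continuous_on_compose2[OF cont]) (intro continuous_intros, auto)
    then show ?thesis unfolding G_def by simp
  qed
  have "continuous_on {a..b} (F u)" for u
    unfolding F_def
    by (intro continuous_intros indefinite_integral_continuous_1 integrable_continuous_real G)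
  then have "continuous_on UNIV (\<lambda>t. F u (cl t))" for u
    by (rule continuous_on_compose2) (auto simp: cl_def ab intro!: continuous_intros)
  moreover have "bounded (range (\<lambda>t. F u (cl t)))" for u
  proof -
    have "bounded (F u ` {a..b})"
      using \<open>continuous_on {a..b} (F u)\<close> by (intro compact_imp_bounded compact_continuous_image) auto
    then show ?thesis by (rule bounded_subset) (use cl in auto)
  qed
  ultimately have "(\<lambda>t. F u (cl t)) \<in> bcontfun" for u unfolding bcontfun_def by auto
  then have P: "apply_bcontfun (Bcontfun (\<lambda>t. F u (cl t))) = (\<lambda>t. F u (cl t))" for u
    by (rule Bcontfun_inverse)
  have contr: "dist (F u t) (F v t) \<le> 1 / 2 * dist u v" if t: "t \<in> {a..b}" for u v t
  proof -
    have G': "G u integrable_on {a..t}" for u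
      using t by (intro integrable_continuous_real continuous_on_subset[OF G]) auto
    have int: "((\<lambda>s. L * dist u v * exp (K * (s - a))) has_integral
        L * dist u v * ((exp (K * (t - a)) - 1) / K)) {a..t}"
      using t K by (intro has_integral_mult_right integral_exp_affine) auto
    have "norm (integral {a..t} (G u) - integral {a..t} (G v)) = norm (integral {a..t} (\<lambda>s. G u s - G v s))"
      using G' by (simp add: integral_diff)
    also have "\<dots> \<le> integral {a..t} (\<lambda>s. L * dist u v * exp (K * (s - a)))"
    proof (rule integral_norm_bound_integral)
      fix s assume s: "s \<in> {a..t}"
      have "norm (G u s - G v s) \<le> L * norm (Z u s - Z v s)"
        unfolding G_def using s t by (intro lip) auto
      also have "norm (Z u s - Z v s) = exp (K * (s - a)) * dist (apply_bcontfun u s) (apply_bcontfun v s)"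
        unfolding Z_def by (simp add: dist_norm flip: scaleR_diff_right)
      also have "L * \<dots> \<le> L * (exp (K * (s - a)) * dist u v)"
        using L by (intro mult_left_mono dist_bounded) auto
      finally show "norm (G u s - G v s) \<le> L * dist u v * exp (K * (s - a))"
        by (simp add: mult_ac)
    qed (use G' int in \<open>auto intro: integrable_diff has_integral_integrable\<close>)
    also have "\<dots> = L * dist u v * ((exp (K * (t - a)) - 1) / K)"
      using int by (rule integral_unique)
    also have "\<dots> \<le> L * dist u v * (exp (K * (t - a)) / K)"
      using L K by (intro mult_left_mono divide_right_mono) auto
    finally have *: "norm (integral {a..t} (G u) - integral {a..t} (G v))
        \<le> L * dist u v * (exp (K * (t - a)) / K)" .
    have "dist (F u t) (F v t) = exp (- K * (t - a)) * norm (integral {a..t} (G u) - integral {a..t} (G v))"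
      unfolding F_def by (simp add: dist_norm flip: scaleR_diff_right)
    also have "\<dots> \<le> exp (- K * (t - a)) * (L * dist u v * (exp (K * (t - a)) / K))"
      using * by (intro mult_left_mono) auto
    also have "\<dots> = (exp (- K * (t - a)) * exp (K * (t - a))) * (L / K * dist u v)"
      by (simp add: field_simps)
    also have "exp (- K * (t - a)) * exp (K * (t - a)) = 1"
      by (simp flip: exp_add)
    also have "1 * (L / K * dist u v) \<le> 1 * (1 / 2 * dist u v)"
      using K by (intro mult_left_mono mult_right_mono) auto
    finally show ?thesis by simp
  qed
  have "\<exists>!u. Bcontfun (\<lambda>t. F u (cl t)) = u"
  proof (rule banach_fix_type[where c = "1 / 2"])
    show "\<forall>u v. dist (Bcontfun (\<lambda>t. F u (cl t))) (Bcontfun (\<lambda>t. F v (cl t))) \<le> 1 / 2 * dist u v"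
      using contr[OF cl] by (intro allI dist_bound) (simp add: P)
  qed auto
  then obtain u where u: "Bcontfun (\<lambda>t. F u (cl t)) = u" by blast
  have "apply_bcontfun u t = F u t" if "t \<in> {a..b}" for t
    using P[of u] u cl_id[OF that] by metis
  then have Zu: "Z u t = x0 + integral {a..t} (G u)" if "t \<in> {a..b}" for t
    unfolding Z_def F_def using that by (simp flip: exp_add)
  show ?thesis
  proof (rule that[of "Z u"])
    show "Z u a = x0" using Zu[of a] ab by simp
    fix t assume t: "t \<in> {a..b}"
    have "((\<lambda>t. x0 + integral {a..t} (G u)) has_vector_derivative 0 + G u t) (at t within {a..b})"
      by (intro has_vector_derivative_add has_vector_derivative_const
          integral_has_vector_derivative G t)
    then show "(Z u has_vector_derivative g (Z u t) t) (at t within {a..b})"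
      using Zu t by (intro has_vector_derivative_transform[of t "{a..b}" "Z u"]) (auto simp: G_def)
  qed
qed

text \<open>The Jacobian is bounded on the compact set, and the ball is convex, so the mean value
  inequality applies.\<close>

lemma smooth_vector_field_lipschitz:
  fixes h :: "real^'n \<Rightarrow> real \<Rightarrow> real^'n"
  assumes h: "smooth_vector_field h"
  obtains L where "0 \<le> L" "\<And>t x y. t \<in> {a..b} \<Longrightarrow> norm x \<le> R \<Longrightarrow> norm y \<le> R \<Longrightarrow>
    norm (h x t - h y t) \<le> L * norm (x - y)"
proof -
  let ?A = "\<lambda>x t. jacobian (\<lambda>y. h y t) (at x)"
  let ?S = "cball (0 :: real^'n) R \<times> {a..b}"
  have "continuous_on ?S (\<lambda>(x, t). ?A x t)"
    using h unfolding smooth_vector_field_def by (auto intro: continuous_on_subset)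
  then have "bounded ((\<lambda>(x, t). ?A x t) ` ?S)"
    by (intro compact_imp_bounded compact_continuous_image compact_Times compact_cball) auto
  then have "\<exists>B. \<forall>x\<in>cball 0 R. \<forall>t\<in>{a..b}. norm (?A x t) \<le> B"
    unfolding bounded_iff by auto
  then obtain B where B: "\<And>x t. x \<in> cball 0 R \<Longrightarrow> t \<in> {a..b} \<Longrightarrow> norm (?A x t) \<le> B" by blast
  have "norm (h x t - h y t) \<le> \<bar>B\<bar> * norm (x - y)"
    if t: "t \<in> {a..b}" and "norm x \<le> R" "norm y \<le> R" for t x y
  proof (rule differentiable_bound[OF convex_cball[of 0 R]])
    fix z :: "real^'n" assume z: "z \<in> cball 0 R"
    have "((\<lambda>x. h x t) has_derivative (*v) (?A z t)) (at z)"
      using h unfolding smooth_vector_field_def by (simp add: jacobian_works)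
    then show "((\<lambda>x. h x t) has_derivative (*v) (?A z t)) (at z within cball 0 R)"
      by (rule has_derivative_at_withinI)
    show "onorm ((*v) (?A z t)) \<le> \<bar>B\<bar>"
    proof (rule onorm_bound)
      fix v
      have "norm (?A z t *v v) \<le> norm (?A z t) * norm v" by (rule norm_matrix_vector_mult_le)
      also have "\<dots> \<le> \<bar>B\<bar> * norm v" using B[OF z t] by (intro mult_right_mono) auto
      finally show "norm (?A z t *v v) \<le> \<bar>B\<bar> * norm v" .
    qed simp
  qed (use that in auto)
  then show ?thesis using that[of "\<bar>B\<bar>"] by simp
qed

lemma solution_on_subset:
  assumes "solution_on h x a b" "a \<le> a'" "b' \<le> b"
  shows "solution_on h x a' b'"
  using assms unfolding solution_on_def
  by (auto intro!: has_vector_derivative_within_subset[where S = "{a..b}" and T = "{a'..b'}"])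

text \<open>Solve the field cut off by the closest-point projection onto a ball, which is globally
  Lipschitz; by the bound the solution never reaches the cut-off region.\<close>

lemma solution_on_exists_of_bound:
  fixes h :: "real^'n \<Rightarrow> real \<Rightarrow> real^'n"
  assumes h: "smooth_vector_field h" and ab: "a \<le> b"
    and bound: "\<And>c x. a \<le> c \<Longrightarrow> c \<le> b \<Longrightarrow> solution_on h x a c \<Longrightarrow> x a = x0 \<Longrightarrow> norm (x c) < R"
  obtains x where "x a = x0" "solution_on h x a b"
proof -
  \<comment> \<open>On the one-point interval the constant function is a solution;
    \<open>bound\<close> then places \<open>x0\<close> in the open ball and yields
    \<open>0 < R\<close>.\<close>
  have "solution_on h (\<lambda>_. x0) a a"
    unfolding solution_on_def by (simp add: has_vector_derivative_def has_derivative_within_singleton_iff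
        bounded_linear_scaleR_left)
  then have x0: "norm x0 < R" using bound[of a "\<lambda>_. x0"] ab by simp
  then have R: "0 < R" using norm_ge_zero le_less_trans by blast
  define pr where "pr = closest_point (cball (0 :: real^'n) R)"
  have ne: "cball (0 :: real^'n) R \<noteq> {}" using R by simp
  have pr_in: "norm (pr x) \<le> R" for x
    using closest_point_in_set[OF closed_cball ne, of x] unfolding pr_def by simp
  have pr_id: "pr x = x" if "norm x \<le> R" for x
    using that unfolding pr_def by (intro closest_point_self) simp
  have pr_lip: "norm (pr x - pr y) \<le> norm (x - y)" for x y
    using closest_point_lipschitz[OF convex_cball closed_cball ne] unfolding pr_def dist_norm .
  have pr_cont: "continuous_on A pr" for A
    unfolding pr_def by (rule continuous_on_closest_point[OF convex_cball closed_cball ne])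
  obtain L where L: "0 \<le> L" "\<And>t x y. t \<in> {a..b} \<Longrightarrow> norm x \<le> R \<Longrightarrow> norm y \<le> R \<Longrightarrow>
      norm (h x t - h y t) \<le> L * norm (x - y)"
    using smooth_vector_field_lipschitz[OF h] by blast
  obtain z where z: "z a = x0"
    "\<And>t. t \<in> {a..b} \<Longrightarrow> (z has_vector_derivative h (pr (z t)) t) (at t within {a..b})"
  proof (rule lipschitz_ode_solution_exists[OF ab, of "\<lambda>x. h (pr x)" L x0])
    have "continuous_on UNIV (\<lambda>(x, t). h x t)" using h unfolding smooth_vector_field_def by auto
    then have "continuous_on (UNIV \<times> {a..b}) (\<lambda>p. (\<lambda>(x, t). h x t) (pr (fst p), snd p))"
      by (rule continuous_on_compose2)
         (intro continuous_intros continuous_on_compose2[OF pr_cont[of UNIV]], auto)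
    then show "continuous_on (UNIV \<times> {a..b}) (\<lambda>(x, t). h (pr x) t)"
      by (simp add: case_prod_beta')
    show "norm (h (pr x) t - h (pr y) t) \<le> L * norm (x - y)" if "t \<in> {a..b}" for t x y
      using L(2)[OF that pr_in pr_in, of x y] mult_left_mono[OF pr_lip[of x y] L(1)] by linarith
  qed (use L(1) in auto)
  have zc: "continuous_on {a..b} z" by (rule continuous_on_vector_derivative) (rule z(2))
  have sol: "solution_on h z a c" if "c \<le> b" "\<And>t. t \<in> {a..c} \<Longrightarrow> norm (z t) \<le> R" for c
    unfolding solution_on_def
  proof
    fix t assume t: "t \<in> {a..c}"
    have "(z has_vector_derivative h (pr (z t)) t) (at t within {a..c})"
      by (rule has_vector_derivative_within_subset[OF z(2)]) (use t that in auto)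
    then show "(z has_vector_derivative h (z t) t) (at t within {a..c})"
      using pr_id[OF that(2)[OF t]] by simp
  qed
  have "norm (z t) < R" if t: "t \<in> {a..b}" for t
  proof (rule ccontr)
    assume "\<not> norm (z t) < R"
    \<comment> \<open>The first time \<open>c\<close> in this closed set is the first exit from the
      open ball. Up to \<open>c\<close> the projection acts as the identity, so \<open>z\<close>
      solves the original equation there and \<open>bound\<close> contradicts the exit.\<close>
    define S where "S = {t \<in> {a..b}. norm (z t) \<in> {R..}}"
    have "closed S"
      unfolding S_def by (intro continuous_closed_preimage[unfolded vimage_def Int_def mem_Collect_eq]
          continuous_on_norm zc) auto
    moreover have "bounded S" unfolding S_def by (rule bounded_subset[of "{a..b}"]) auto
    moreover have "S \<noteq> {}" using t \<open>\<not> norm (z t) < R\<close> unfolding S_def by auto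
    ultimately obtain c where c: "c \<in> S" "\<And>s. s \<in> S \<Longrightarrow> c \<le> s"
      using compact_attains_inf[of S] compact_eq_bounded_closed by blast
    then have cab: "c \<in> {a..b}" "R \<le> norm (z c)" unfolding S_def by auto
    have "continuous_on {a..c} (\<lambda>s. norm (z s))"
      using cab by (intro continuous_on_norm continuous_on_subset[OF zc]) auto
    \<comment> \<open>By the intermediate value theorem the norm equals \<open>R\<close> at some
      time up to \<open>c\<close>; minimality makes that time \<open>c\<close>, so
      \<open>z c\<close> itself still lies in the closed ball.\<close>
    then obtain s where s: "a \<le> s" "s \<le> c" "norm (z s) = R"
      using IVT'[of "\<lambda>s. norm (z s)" a R c] cab x0 z(1) by auto
    then have "s \<in> S" using cab unfolding S_def by auto
    then have "s = c" using c(2) s(2) by force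
    have "norm (z r) \<le> R" if "r \<in> {a..c}" for r
    proof (cases "r = c")
      case False
      then have "r \<notin> S" using c(2) that by force
      then show ?thesis using that cab unfolding S_def by auto
    qed (use s \<open>s = c\<close> in auto)
    then have "norm (z c) < R"
      using cab by (intro bound sol z(1)) auto
    then show False using cab by simp
  qed
  then have "solution_on h z a b" by (intro sol) (auto simp: less_imp_le)
  then show ?thesis using that z(1) by blast
qed

subsection \<open>Semi-contracting systems\<close>

text \<open>Derivatives are local: near \<open>t\<close>, the half-line and
  \<open>{t0..t + 1}\<close> coincide, the \<open>+ 1\<close> placing \<open>t\<close> away from the
  right end.\<close>

lemma forward_solution_iff:
  "forward_solution h x0 t0 x \<longleftrightarrow> x t0 = x0 \<and> (\<forall>T. solution_on h x t0 T)"
proof -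
  have "(x has_vector_derivative h (x t) t) (at t within {t0..})"
    if "t0 \<le> t" "solution_on h x t0 (t + 1)" for t
  proof -
    have "at t within {t0..t + 1} = at t within {t0..}"
      by (rule at_within_nhd[of t "{..<t + 1}"]) auto
    then show ?thesis using that unfolding solution_on_def by (metis atLeastAtMost_iff le_add_same_cancel1 zero_le_one)
  qed
  moreover have "(x has_vector_derivative h (x t) t) (at t within {t0..T})"
    if "(x has_vector_derivative h (x t) t) (at t within {t0..})" for t T
    using that by (rule has_vector_derivative_within_subset) auto
  ultimately show ?thesis
    unfolding forward_solution_def by (auto simp: solution_on_def[of h x])
qed

lemma complete_trajectory_solution_on: "complete_trajectory h x \<Longrightarrow> solution_on h x a b"
  unfolding complete_trajectory_def solution_on_def by (blast intro: has_vector_derivative_at_within)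

text \<open>Convergence is invariant under time shifts; as \<open>t\<close> is arbitrary, attraction
  may be checked from any starting time.\<close>

lemma tends_asymptotically_to_iff:
  "tends_asymptotically_to x xs \<longleftrightarrow> ((\<lambda>T. x (t + T) - xs (t + T)) \<longlongrightarrow> 0) at_top"
proof -
  define f where "f = (\<lambda>s. x s - xs s)"
  have shift: "LIM T at_top. c + T :> at_top" for c :: real
    by (rule filterlim_tendsto_add_at_top[OF tendsto_const filterlim_ident])
  have "((\<lambda>T. f (t + T)) \<longlongrightarrow> 0) at_top" if "(f \<longlongrightarrow> 0) at_top"
    by (rule filterlim_compose[OF that shift])
  moreover have "(f \<longlongrightarrow> 0) at_top" if "((\<lambda>T. f (t + T)) \<longlongrightarrow> 0) at_top"
    using filterlim_compose[OF that shift[of "- t"]] by simp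
  ultimately show ?thesis
    unfolding tends_asymptotically_to_def tendsto_norm_zero_iff f_def by blast
qed

lemma forward_solution_from_later_time:
  assumes "forward_solution h x0 t0 x" "t0 \<le> t1"
  shows "forward_solution h (x t1) t1 x"
  using assms unfolding forward_solution_iff by (blast intro: solution_on_subset order_refl)

section \<open>Global existence and attraction for a semi-contracting system\<close>

context
  fixes h :: "real^'n \<Rightarrow> real \<Rightarrow> real^'n" and M :: "real^'n \<Rightarrow> real^'n^'n" and \<beta>\<^sub>0 \<beta>\<^sub>1 :: real
  assumes h: "smooth_vector_field h" and M: "bounded_metric M \<beta>\<^sub>0 \<beta>\<^sub>1" and semi: "semi_contracting h M"
begin

text \<open>The contraction condition holds everywhere, so the tube radius is free: \<rho> is chosen
  so large that the smallness hypothesis of \<open>contraction_estimate\<close> holds. The Lipschitz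
  constant does not depend on time.\<close>

lemma semi_contracting_lipschitz:
  assumes x: "solution_on h x a b" and y: "solution_on h y a b" and ab: "a \<le> b"
  shows "norm (x b - y b) \<le> \<bar>\<beta>\<^sub>1\<bar> / \<bar>\<beta>\<^sub>0\<bar> * norm (x a - y a)"
proof -
  have \<beta>0: "0 < \<bar>\<beta>\<^sub>0\<bar>" using bounded_metric_lower_pos[OF M] by simp
  let ?r = "\<bar>\<beta>\<^sub>1\<bar> * norm (x a - y a)"
  define \<rho> where "\<rho> = (?r + 1) / \<bar>\<beta>\<^sub>0\<bar>"
  have \<rho>: "0 < \<rho>" unfolding \<rho>_def using \<beta>0 by (intro divide_pos_pos add_nonneg_pos) auto
  have "\<beta>\<^sub>1\<^sup>2 * (norm (x a - y a))\<^sup>2 = ?r\<^sup>2" by (simp add: power_mult_distrib)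
  also have "\<dots> < (?r + 1)\<^sup>2" by (intro power_strict_mono) auto
  also have "\<dots> = (\<bar>\<beta>\<^sub>0\<bar> * \<rho>)\<^sup>2" unfolding \<rho>_def using \<beta>0 by simp
  also have "\<dots> = \<beta>\<^sub>0\<^sup>2 * \<rho>\<^sup>2" by (simp add: power_mult_distrib)
  finally have "\<beta>\<^sub>0\<^sup>2 * (norm (x b - y b))\<^sup>2
      \<le> exp (- 2 * 0 * (b - a)) * (\<beta>\<^sub>1\<^sup>2 * (norm (x a - y a))\<^sup>2)"
    using semi unfolding semi_contracting_def
    by (intro contraction_estimate[OF h M order_refl x y ab _ \<rho>]) auto
  then have "(\<bar>\<beta>\<^sub>0\<bar> * norm (x b - y b))\<^sup>2 \<le> ?r\<^sup>2"
    by (simp add: power_mult_distrib)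
  then have "\<bar>\<beta>\<^sub>0\<bar> * norm (x b - y b) \<le> ?r"
    by (rule power2_le_imp_le) simp
  then show ?thesis using \<beta>0 by (simp add: field_simps)
qed

lemma semi_contracting_unique:
  assumes "solution_on h x a b" "solution_on h y a b" "a \<le> b" "x a = y a"
  shows "x b = y b"
  using semi_contracting_lipschitz[OF assms(1-3)] assms(4) by simp

text \<open>The distance to the complete trajectory \<open>xs\<close> stays bounded, which gives the
  a priori bound for existence on each \<open>{t0..T}\<close>.\<close>

lemma semi_contracting_forward_solution_exists:
  assumes xs: "complete_trajectory h xs"
  obtains x where "forward_solution h x0 t0 x"
proof -
  let ?C = "\<bar>\<beta>\<^sub>1\<bar> / \<bar>\<beta>\<^sub>0\<bar>"
  have "\<exists>x. x t0 = x0 \<and> solution_on h x t0 T" if T: "t0 \<le> T" for T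
  proof -
    have "bounded (xs ` {t0..T})"
      by (intro compact_imp_bounded compact_continuous_image
          solution_on_continuous[OF complete_trajectory_solution_on[OF xs]]) auto
    then obtain r where r: "\<And>t. t \<in> {t0..T} \<Longrightarrow> norm (xs t) \<le> r" unfolding bounded_iff by blast
    have "norm (x c) < r + ?C * norm (x0 - xs t0) + 1"
      if c: "t0 \<le> c" "c \<le> T" and x: "solution_on h x t0 c" "x t0 = x0" for c x
      using semi_contracting_lipschitz[OF x(1) complete_trajectory_solution_on[OF xs] c(1)]
        r[of c] c x(2) norm_triangle_ineq[of "xs c" "x c - xs c"] by simp
    then show ?thesis
      using solution_on_exists_of_bound[OF h T, of x0] by blast
  qed
  then have "\<forall>T. \<exists>x. t0 \<le> T \<longrightarrow> x t0 = x0 \<and> solution_on h x t0 T" by blast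
  then obtain X where "\<forall>T. t0 \<le> T \<longrightarrow> X T t0 = x0 \<and> solution_on h (X T) t0 T" by (rule choice[THEN exE])
  then have X: "X T t0 = x0 \<and> solution_on h (X T) t0 T" if "t0 \<le> T" for T using that by blast
  have X_eq: "X T t = X t t" if "t0 \<le> t" "t \<le> T" for t T
  proof (rule semi_contracting_unique[of "X T" t0 t "X t"])
    show "solution_on h (X T) t0 t"
      by (rule solution_on_subset[of h "X T" t0 T]) (use X[of T] that in auto)
    show "solution_on h (X t) t0 t" "X T t0 = X t t0" using X that by auto
  qed (use that in auto)
  \<comment> \<open>By uniqueness the solutions \<open>X T\<close> extend one another, so the
    diagonal agrees with \<open>X T\<close> on \<open>{t0..T}\<close>.\<close>
  have "solution_on h (\<lambda>t. X t t) t0 T" for T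
    unfolding solution_on_def
  proof
    fix t assume t: "t \<in> {t0..T}"
    then have "(X T has_vector_derivative h (X T t) t) (at t within {t0..T})"
      using X[of T] unfolding solution_on_def by auto
    then have "((\<lambda>t. X t t) has_vector_derivative h (X T t) t) (at t within {t0..T})"
      by (rule has_vector_derivative_transform[OF t, rotated]) (rule X_eq[symmetric], simp_all)
    then show "((\<lambda>t. X t t) has_vector_derivative h (X t t) t) (at t within {t0..T})"
      using X_eq[of t T] t by simp
  qed
  moreover have "X t0 t0 = x0" using X by blast
  ultimately have "forward_solution h x0 t0 (\<lambda>t. X t t)" unfolding forward_solution_iff by blast
  then show ?thesis by (rule that)
qed

text \<open>A chain of points from \<open>xs t0\<close> to \<open>x0\<close> with small gaps: by the uniform Lipschitz bound,
  attraction passes from each point of the chain to the next.\<close>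

lemma semi_contracting_locally_attractive_imp_globally:
  assumes xs: "complete_trajectory h xs" and attr: "locally_attractive h xs"
  shows "all_trajectories_tend_to h xs"
  unfolding all_trajectories_tend_to_def
proof (intro allI conjI impI)
  fix t0 x0
  show "\<exists>x. forward_solution h x0 t0 x"
    using semi_contracting_forward_solution_exists[OF xs] by blast
  fix x assume x: "forward_solution h x0 t0 x"
  obtain \<epsilon> where \<epsilon>: "0 < \<epsilon>" and loc: "\<And>t1 y0 y. y0 \<in> ball (xs t1) \<epsilon> \<Longrightarrow> forward_solution h y0 t1 y \<Longrightarrow>
      ((\<lambda>T. y (t1 + T) - xs (t1 + T)) \<longlongrightarrow> 0) at_top"
    using attr unfolding locally_attractive_def by blast
  let ?C = "\<bar>\<beta>\<^sub>1\<bar> / \<bar>\<beta>\<^sub>0\<bar>"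
  define w where "w = x0 - xs t0"
  \<comment> \<open>So many links that two solutions starting at neighbouring points of the chain
    stay less than half of \<epsilon> apart forever.\<close>
  obtain N :: nat where N: "?C * norm w / (\<epsilon> / 2) < real N" using reals_Archimedean2 by blast
  moreover have "0 \<le> ?C * norm w / (\<epsilon> / 2)" using \<epsilon> by simp
  ultimately have N0: "0 < real N" by linarith
  have step: "?C * (norm w / N) < \<epsilon> / 2" 
  proof -
    have "?C * norm w < real N * (\<epsilon> / 2)"
      using N \<epsilon> by (subst (asm) pos_divide_less_eq) auto
    then have "?C * norm w / N < \<epsilon> / 2"
      using N0 by (subst pos_divide_less_eq) (auto simp: mult.commute)
    then show ?thesis by simp
  qed
  have "\<forall>y. forward_solution h (xs t0 + (real k / N) *\<^sub>R w) t0 y \<longrightarrow> tends_asymptotically_to y xs" for k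
  proof (induction k)
    case 0
    show ?case
      using loc[of "xs t0" t0] \<epsilon> unfolding tends_asymptotically_to_iff[of _ xs t0] by simp
  next
    case (Suc k)
    show ?case
    proof (intro allI impI)
      fix y assume y: "forward_solution h (xs t0 + (real (Suc k) / N) *\<^sub>R w) t0 y"
      obtain z where z: "forward_solution h (xs t0 + (real k / N) *\<^sub>R w) t0 z"
        using semi_contracting_forward_solution_exists[OF xs] by blast
      then have "tends_asymptotically_to z xs" using Suc.IH by blast
      then have "\<forall>\<^sub>F t in at_top. norm (z t - xs t) < \<epsilon> / 2"
        using \<epsilon> unfolding tends_asymptotically_to_def by (intro order_tendstoD(2)) auto
      \<comment> \<open>At \<open>t1\<close> the attracted solution \<open>z\<close> is within half
        of \<epsilon> of \<open>xs\<close>, and \<open>y\<close> is equally close to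
        \<open>z\<close>, so \<open>y\<close> lies in the attraction ball. Its radius is the same
        for every initial time, so attraction restarts at \<open>t1\<close>.\<close>
      then obtain t1 where t1: "t0 \<le> t1" "norm (z t1 - xs t1) < \<epsilon> / 2"
        using eventually_happens[OF eventually_conj[OF eventually_ge_at_top[of t0]]] by force
      have "y t0 - z t0 = (1 / N) *\<^sub>R w"
        using y z unfolding forward_solution_def
        by (simp add: add_divide_distrib scaleR_left_distrib)
      then have "norm (y t0 - z t0) = norm w / N" by simp
      then have "norm (y t1 - z t1) < \<epsilon> / 2"
        using semi_contracting_lipschitz[of y t0 t1 z] y z t1(1) step unfolding forward_solution_iff
        by (smt (verit))
      then have "norm (xs t1 - y t1) < \<epsilon>"
        using t1(2) norm_triangle_ineq[of "y t1 - z t1" "z t1 - xs t1"]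
        by (simp add: norm_minus_commute[of "xs t1"])
      then have "((\<lambda>T. y (t1 + T) - xs (t1 + T)) \<longlongrightarrow> 0) at_top"
        by (intro loc[OF _ forward_solution_from_later_time[OF y t1(1)]]) (simp add: dist_norm)
      then show "tends_asymptotically_to y xs" unfolding tends_asymptotically_to_iff[of _ xs t1] .
    qed
  qed
  from this[of N] x N0 show "tends_asymptotically_to x xs" unfolding w_def by simp
qed

text \<open>\<open>contraction_estimate\<close> with \<open>xs\<close> as the reference solution
  gives exponential decay for starts so close that the curves cannot leave the tube. Existence of
  these solutions comes from semi-contraction in \<open>M\<close>.\<close>

lemma contracting_in_tube_imp_locally_attractive:
  assumes xs: "complete_trajectory h xs" and tube: "contracting_in_tube h xs"
  shows "locally_attractive h xs"
proof -
  obtain M' \<gamma>\<^sub>0 \<gamma>\<^sub>1 \<alpha> \<epsilon> where M': "bounded_metric M' \<gamma>\<^sub>0 \<gamma>\<^sub>1" and \<alpha>: "0 < \<alpha>" and \<epsilon>: "0 < \<epsilon>"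
    and con: "\<And>t p. p \<in> ball (xs t) \<epsilon> \<Longrightarrow> contraction_condition h M' \<alpha> p t"
    using tube unfolding contracting_in_tube_def by blast
  have \<gamma>0: "0 < \<bar>\<gamma>\<^sub>0\<bar>" using bounded_metric_lower_pos[OF M'] by simp
  \<comment> \<open>The \<open>+ 1\<close> avoids division by zero and makes
    \<open>\<bar>\<gamma>\<^sub>1\<bar> * r < \<bar>\<gamma>\<^sub>0\<bar> * \<epsilon>\<close>
    strict, as the smallness hypothesis demands.\<close>
  define r where "r = \<bar>\<gamma>\<^sub>0\<bar> * \<epsilon> / (\<bar>\<gamma>\<^sub>1\<bar> + 1)"
  have r: "0 < r" unfolding r_def using \<gamma>0 \<epsilon> by (intro divide_pos_pos mult_pos_pos) auto
  have r': "\<bar>\<gamma>\<^sub>1\<bar> * r < \<bar>\<gamma>\<^sub>0\<bar> * \<epsilon>"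
  proof -
    have "(\<bar>\<gamma>\<^sub>1\<bar> + 1) * r = \<bar>\<gamma>\<^sub>0\<bar> * \<epsilon>" unfolding r_def by simp
    then show ?thesis using r by (simp add: distrib_right)
  qed
  have "((\<lambda>T. x (t0 + T) - xs (t0 + T)) \<longlongrightarrow> 0) at_top"
    if x0: "x0 \<in> ball (xs t0) r" and x: "forward_solution h x0 t0 x" for t0 x0 x
  proof -
    define d where "d = norm (xs t0 - x t0)"
    have d: "0 \<le> d" "d < r" using x0 x unfolding d_def forward_solution_def by (auto simp: dist_norm)
    have "\<gamma>\<^sub>1\<^sup>2 * d\<^sup>2 = (\<bar>\<gamma>\<^sub>1\<bar> * d)\<^sup>2" by (simp add: power_mult_distrib)
    also have "\<dots> \<le> (\<bar>\<gamma>\<^sub>1\<bar> * r)\<^sup>2" using d by (intro power_mono mult_left_mono) auto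
    also have "\<dots> < (\<bar>\<gamma>\<^sub>0\<bar> * \<epsilon>)\<^sup>2" using r' r by (intro power_strict_mono) auto
    also have "\<dots> = \<gamma>\<^sub>0\<^sup>2 * \<epsilon>\<^sup>2" by (simp add: power_mult_distrib)
    finally have small: "\<gamma>\<^sub>1\<^sup>2 * d\<^sup>2 < \<gamma>\<^sub>0\<^sup>2 * \<epsilon>\<^sup>2" .
    have bound: "norm (x (t0 + T) - xs (t0 + T)) \<le> \<bar>\<gamma>\<^sub>1\<bar> * d / \<bar>\<gamma>\<^sub>0\<bar> * exp (- \<alpha> * T)" if "0 \<le> T" for T
    proof -
      have "\<gamma>\<^sub>0\<^sup>2 * (norm (xs (t0 + T) - x (t0 + T)))\<^sup>2
          \<le> exp (- 2 * \<alpha> * (t0 + T - t0)) * (\<gamma>\<^sub>1\<^sup>2 * (norm (xs t0 - x t0))\<^sup>2)"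
        using x that \<alpha> small con unfolding d_def forward_solution_iff
        by (intro contraction_estimate[OF h M' _ complete_trajectory_solution_on[OF xs], where \<rho> = \<epsilon>])
           (auto simp: \<epsilon>)
      also have "exp (- 2 * \<alpha> * (t0 + T - t0)) = (exp (- \<alpha> * T))\<^sup>2"
        by (simp add: exp_double[symmetric])
      finally have "(\<bar>\<gamma>\<^sub>0\<bar> * norm (x (t0 + T) - xs (t0 + T)))\<^sup>2 \<le> (exp (- \<alpha> * T) * (\<bar>\<gamma>\<^sub>1\<bar> * d))\<^sup>2"
        unfolding d_def by (simp add: power_mult_distrib norm_minus_commute)
      then have "\<bar>\<gamma>\<^sub>0\<bar> * norm (x (t0 + T) - xs (t0 + T)) \<le> exp (- \<alpha> * T) * (\<bar>\<gamma>\<^sub>1\<bar> * d)"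
        by (rule power2_le_imp_le) (simp add: d)
      then show ?thesis using \<gamma>0 by (simp add: field_simps)
    qed
    have "filterlim (\<lambda>T. - \<alpha> * T) at_bot at_top"
      using \<alpha> by (intro filterlim_tendsto_neg_mult_at_bot[OF tendsto_const _ filterlim_ident]) simp
    then have "((\<lambda>T. exp (- \<alpha> * T)) \<longlongrightarrow> 0) at_top"
      by (rule filterlim_compose[OF exp_at_bot])
    then have "((\<lambda>T. \<bar>\<gamma>\<^sub>1\<bar> * d / \<bar>\<gamma>\<^sub>0\<bar> * exp (- \<alpha> * T)) \<longlongrightarrow> 0) at_top"
      by (rule tendsto_mult_right_zero)
    then show ?thesis
      by (rule Lim_null_comparison[rotated])
         (use bound in \<open>auto intro: eventually_mono[OF eventually_ge_at_top[of 0]]\<close>)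
  qed
  then show ?thesis
    unfolding locally_attractive_def
  proof (intro exI[of _ r] conjI r allI ballI impI)
    show "\<exists>x. forward_solution h x0 t0 x" for x0 t0
      using semi_contracting_forward_solution_exists[OF xs] by blast
  qed
qed

end

text \<open>The second claim reduces to the first, since contraction in a tube implies local
  attractivity.\<close>

theorem theorem3:
  fixes h :: "real^'n \<Rightarrow> real \<Rightarrow> real^'n"
    and M :: "real^'n \<Rightarrow> real^'n^'n"
    and \<beta>\<^sub>0 \<beta>\<^sub>1 :: real
    and xs :: "real \<Rightarrow> real^'n"
  assumes "smooth_vector_field h"
    and "bounded_metric M \<beta>\<^sub>0 \<beta>\<^sub>1"
    and "semi_contracting h M"
    and "complete_trajectory h xs"
  shows "(locally_attractive h xs \<longrightarrow> all_trajectories_tend_to h xs) \<and>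
    (contracting_in_tube h xs \<longrightarrow> all_trajectories_tend_to h xs)"
  using semi_contracting_locally_attractive_imp_globally[OF assms]
    contracting_in_tube_imp_locally_attractive[OF assms] by argo

end
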